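(* Let $\mathscr{D}$ be a small category, $X:\mathscr{D}^{op}\to\mathrm{Set}$ a $\mathscr{D}$-set, and $\mathcal{G}:(\mathscr{D}\downarrow X)^{op}\to\mathrm{Grp}$ a group diagram. Then there are natural isomorphisms $$\mathrm{colim}^{(\mathscr{D}\downarrow X)^{op}}_n\mathcal{G}\cong H_n(X,\mathcal{G})$$ for all $n\geq 0$. The functor $C^{\mathscr{D}}_*(X,\mathcal{G})=\mathrm{Lan}^{Q_X^{op}}\mathcal{G}:\mathscr{D}^{op}\to\mathrm{Grp}$ associates with each $a\in\mathscr{D}$ the free product $C^{\mathscr{D}}_a(X,\mathcal{G})=\star_{z\in X(a)}\mathcal{G}(z)$, and with each morphism $\alpha:b\to a$ of $\mathscr{D}$ the homomorphism $$C^{\mathscr{D}}_*(X,\mathcal{G})(\alpha):\ \star_{z\in X(a)}\mathcal{G}(z)\to\star_{z\in X(b)}\mathcal{G}(z)$$ acting on elements of the free factors as $$(x\in X(a),\ g\in\mathcal{G}(x))\mapsto\big(X(\alpha)(x)\in X(b),\ \mathcal{G}(x\xrightarrow{\alpha}X(\alpha)(x))(g)\in\mathcal{G}(X(\alpha)(x))\big).$$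
   Context: A $\mathscr{D}$-set is a functor $X:\mathscr{D}^{op}\to\mathrm{Set}$. $\mathscr{D}\downarrow X$ is the category of elements of $X$: the comma category $h^{\mathscr{D}}\downarrow X$ for the Yoneda embedding $h^{\mathscr{D}}$. By Yoneda, its objects are pairs $(a,x)$ with $a\in\mathrm{Ob}\,\mathscr{D}$, $x\in X(a)$ (written simply $x$), and a morphism $(b,y)\to(a,x)$ is a morphism $\alpha:b\to a$ in $\mathscr{D}$ with $X(\alpha)(x)=y$; the corresponding morphism in $(\mathscr{D}\downarrow X)^{op}$ is written $x\xrightarrow{\alpha}X(\alpha)(x)$. $Q_X:\mathscr{D}\downarrow X\to\mathscr{D}$ is the forgetful functor $(a,x)\mapsto a$, and $\mathrm{Lan}^{Q_X^{op}}$ is the left Kan extension along $Q_X^{op}:(\mathscr{D}\downarrow X)^{op}\to\mathscr{D}^{op}$. For a small category $\mathscr{C}$ and a functor (group diagram) $\mathcal{G}:\mathscr{C}\to\mathrm{Grp}$, the simplicial replacement is the simplicial group $C_*(\mathscr{C},\mathcal{G})$ with $C_n(\mathscr{C},\mathcal{G})=\star_{c_0\to\cdots\to c_n}\mathcal{G}(c_0)$ (free product over $n$-simplices of the nerve), where $d^0_n$ sends $(c_0\xrightarrow{\alpha_1}c_1\to\cdots\to c_n,x)$ to $(c_1\to\cdots\to c_n,\mathcal{G}(\alpha_1)(x))$, $d^i_n$ for $i>0$ takes the $i$-th face of the nerve simplex and keeps $x$, and $s^i_n$ inserts the identity of $c_i$ and keeps $x$. The non-Abelian homology groups are $\mathrm{colim}^{\mathscr{C}}_n\mathcal{G}:=\pi_n(C_*(\mathscr{C},\mathcal{G}))$,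 $n\ge0$. The non-Abelian homology of the $\mathscr{D}$-set $X$ with coefficients in $\mathcal{G}:(\mathscr{D}\downarrow X)^{op}\to\mathrm{Grp}$ is $H_n(X,\mathcal{G}):=\mathrm{colim}^{\mathscr{D}^{op}}_n\,\mathrm{Lan}^{Q_X^{op}}\mathcal{G}$, $n\geq0$. *)

theory Defs
  imports "HOL-Algebra.Coset"
begin

text \<open>\<open>Cmp C \<beta> \<alpha>\<close> is the composite ``first \<open>\<alpha>\<close>, then \<open>\<beta>\<close>''; it is only meaningful when
  \<open>Cod C \<alpha> = Dom C \<beta>\<close>.\<close>

record ('o, 'a) cat =
  Ob :: "'o set"
  Ar :: "'a set"
  Dom :: "'a \<Rightarrow> 'o"
  Cod :: "'a \<Rightarrow> 'o"
  Idn :: "'o \<Rightarrow> 'a"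
  Cmp :: "'a \<Rightarrow> 'a \<Rightarrow> 'a"

definition category :: "('o, 'a) cat \<Rightarrow> bool" where
  "category C \<longleftrightarrow>
     (\<forall>\<alpha>\<in>Ar C. Dom C \<alpha> \<in> Ob C \<and> Cod C \<alpha> \<in> Ob C) \<and>
     (\<forall>c\<in>Ob C. Idn C c \<in> Ar C \<and> Dom C (Idn C c) = c \<and> Cod C (Idn C c) = c) \<and>
     (\<forall>\<alpha>\<in>Ar C. \<forall>\<beta>\<in>Ar C. Cod C \<alpha> = Dom C \<beta> \<longrightarrow>
        Cmp C \<beta> \<alpha> \<in> Ar C \<and> Dom C (Cmp C \<beta> \<alpha>) = Dom C \<alpha> \<and> Cod C (Cmp C \<beta> \<alpha>) = Cod C \<beta>) \<and>
     (\<forall>\<alpha>\<in>Ar C. Cmp C \<alpha> (Idn C (Dom C \<alpha>)) = \<alpha> \<and> Cmp C (Idn C (Cod C \<alpha>)) \<alpha> = \<alpha>) \<and>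
     (\<forall>\<alpha>\<in>Ar C. \<forall>\<beta>\<in>Ar C. \<forall>\<gamma>\<in>Ar C. Cod C \<alpha> = Dom C \<beta> \<longrightarrow> Cod C \<beta> = Dom C \<gamma> \<longrightarrow>
        Cmp C \<gamma> (Cmp C \<beta> \<alpha>) = Cmp C (Cmp C \<gamma> \<beta>) \<alpha>)"

definition opcat :: "('o, 'a) cat \<Rightarrow> ('o, 'a) cat" where
  "opcat C = \<lparr>Ob = Ob C, Ar = Ar C, Dom = Cod C, Cod = Dom C, Idn = Idn C,
              Cmp = (\<lambda>\<beta> \<alpha>. Cmp C \<alpha> \<beta>)\<rparr>"

record ('o, 'a, 'p, 'b) cfunctor =
  fob :: "'o \<Rightarrow> 'p"
  far :: "'a \<Rightarrow> 'b"

definition is_functor :: "('o, 'a) cat \<Rightarrow> ('p, 'b) cat \<Rightarrow> ('o, 'a, 'p, 'b) cfunctor \<Rightarrow> bool" where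
  "is_functor A B F \<longleftrightarrow> category A \<and> category B \<and>
     (\<forall>c\<in>Ob A. fob F c \<in> Ob B) \<and>
     (\<forall>\<alpha>\<in>Ar A. far F \<alpha> \<in> Ar B \<and> Dom B (far F \<alpha>) = fob F (Dom A \<alpha>)
                              \<and> Cod B (far F \<alpha>) = fob F (Cod A \<alpha>)) \<and>
     (\<forall>c\<in>Ob A. far F (Idn A c) = Idn B (fob F c)) \<and>
     (\<forall>\<alpha>\<in>Ar A. \<forall>\<beta>\<in>Ar A. Cod A \<alpha> = Dom A \<beta> \<longrightarrow>
        far F (Cmp A \<beta> \<alpha>) = Cmp B (far F \<beta>) (far F \<alpha>))"

text \<open>Covariant functors from \<open>C\<close> to sets, resp. groups. As \<open>C\<close> is small, the sets (underlying sets
  of the groups) can be taken inside one type. The maps assigned to arrows matter only on the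
  sets (carriers).\<close>

record ('o, 'a, 'x) set_diag =
  sob :: "'o \<Rightarrow> 'x set"
  sar :: "'a \<Rightarrow> 'x \<Rightarrow> 'x"

definition set_diagram :: "('o, 'a) cat \<Rightarrow> ('o, 'a, 'x) set_diag \<Rightarrow> bool" where
  "set_diagram C X \<longleftrightarrow> category C \<and>
     (\<forall>\<alpha>\<in>Ar C. sar X \<alpha> \<in> sob X (Dom C \<alpha>) \<rightarrow> sob X (Cod C \<alpha>)) \<and>
     (\<forall>c\<in>Ob C. \<forall>x\<in>sob X c. sar X (Idn C c) x = x) \<and>
     (\<forall>\<alpha>\<in>Ar C. \<forall>\<beta>\<in>Ar C. Cod C \<alpha> = Dom C \<beta> \<longrightarrow>
        (\<forall>x\<in>sob X (Dom C \<alpha>). sar X (Cmp C \<beta> \<alpha>) x = sar X \<beta> (sar X \<alpha> x)))"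

record ('o, 'a, 'g) grp_diag =
  gob :: "'o \<Rightarrow> 'g monoid"
  gar :: "'a \<Rightarrow> 'g \<Rightarrow> 'g"

definition group_diagram :: "('o, 'a) cat \<Rightarrow> ('o, 'a, 'g) grp_diag \<Rightarrow> bool" where
  "group_diagram C G \<longleftrightarrow> category C \<and>
     (\<forall>c\<in>Ob C. group (gob G c)) \<and>
     (\<forall>\<alpha>\<in>Ar C. gar G \<alpha> \<in> hom (gob G (Dom C \<alpha>)) (gob G (Cod C \<alpha>))) \<and>
     (\<forall>c\<in>Ob C. \<forall>x\<in>carrier (gob G c). gar G (Idn C c) x = x) \<and>
     (\<forall>\<alpha>\<in>Ar C. \<forall>\<beta>\<in>Ar C. Cod C \<alpha> = Dom C \<beta> \<longrightarrow>
        (\<forall>x\<in>carrier (gob G (Dom C \<alpha>)). gar G (Cmp C \<beta> \<alpha>) x = gar G \<beta> (gar G \<alpha> x)))"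

definition nat_trans ::
  "('o, 'a) cat \<Rightarrow> ('o, 'a, 'g) grp_diag \<Rightarrow> ('o, 'a, 'h) grp_diag \<Rightarrow> ('o \<Rightarrow> 'g \<Rightarrow> 'h) \<Rightarrow> bool" where
  "nat_trans C G H \<theta> \<longleftrightarrow>
     (\<forall>c\<in>Ob C. \<theta> c \<in> hom (gob G c) (gob H c)) \<and>
     (\<forall>\<alpha>\<in>Ar C. \<forall>x\<in>carrier (gob G (Dom C \<alpha>)).
        \<theta> (Cod C \<alpha>) (gar G \<alpha> x) = gar H \<alpha> (\<theta> (Dom C \<alpha>) x))"

definition precomp :: "('p, 'b, 'g) grp_diag \<Rightarrow> ('o, 'a, 'p, 'b) cfunctor \<Rightarrow> ('o, 'a, 'g) grp_diag" where
  "precomp L F = \<lparr>gob = (\<lambda>c. gob L (fob F c)), gar = (\<lambda>\<alpha>. gar L (far F \<alpha>))\<rparr>"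

text \<open>\<open>(L, \<eta>)\<close> is a left Kan extension of \<open>G : A \<rightarrow> Grp\<close> along \<open>F : A \<rightarrow> B\<close>: every transformation
  \<open>\<gamma> : G \<Rightarrow> H \<circ> F\<close> factors uniquely through \<open>\<eta>\<close>. HOL cannot quantify over types inside a
  formula, so the type of the elements of the test diagrams \<open>H\<close> is a parameter.\<close>

definition left_Kan ::
  "'h itself \<Rightarrow> ('o, 'a) cat \<Rightarrow> ('p, 'b) cat \<Rightarrow> ('o, 'a, 'p, 'b) cfunctor \<Rightarrow> ('o, 'a, 'g) grp_diag \<Rightarrow>
   ('p, 'b, 'l) grp_diag \<Rightarrow> ('o \<Rightarrow> 'g \<Rightarrow> 'l) \<Rightarrow> bool" where
  "left_Kan T A B F G L \<eta> \<longleftrightarrow>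
     is_functor A B F \<and> group_diagram A G \<and> group_diagram B L \<and> nat_trans A G (precomp L F) \<eta> \<and>
     (\<forall>(H :: ('p, 'b, 'h) grp_diag) \<gamma>.
        group_diagram B H \<and> nat_trans A G (precomp H F) \<gamma> \<longrightarrow>
        (\<exists>\<sigma>. nat_trans B L H \<sigma> \<and>
             (\<forall>c\<in>Ob A. \<forall>x\<in>carrier (gob G c). \<sigma> (fob F c) (\<eta> c x) = \<gamma> c x) \<and>
             (\<forall>\<tau>. nat_trans B L H \<tau> \<and>
                  (\<forall>c\<in>Ob A. \<forall>x\<in>carrier (gob G c). \<tau> (fob F c) (\<eta> c x) = \<gamma> c x) \<longrightarrow>
                  (\<forall>b\<in>Ob B. \<forall>y\<in>carrier (gob L b). \<tau> b y = \<sigma> b y))))"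

definition fp_words :: "'i set \<Rightarrow> ('i \<Rightarrow> 'g monoid) \<Rightarrow> ('i \<times> 'g) list set" where
  "fp_words I G = lists (SIGMA i:I. carrier (G i))"

inductive fp_eq :: "'i set \<Rightarrow> ('i \<Rightarrow> 'g monoid) \<Rightarrow> ('i \<times> 'g) list \<Rightarrow> ('i \<times> 'g) list \<Rightarrow> bool"
  for I :: "'i set" and G :: "'i \<Rightarrow> 'g monoid" where
  refl: "w \<in> fp_words I G \<Longrightarrow> fp_eq I G w w"
| sym: "fp_eq I G v w \<Longrightarrow> fp_eq I G w v"
| trans: "fp_eq I G u v \<Longrightarrow> fp_eq I G v w \<Longrightarrow> fp_eq I G u w"
| unit: "u \<in> fp_words I G \<Longrightarrow> v \<in> fp_words I G \<Longrightarrow> i \<in> I \<Longrightarrow>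
     fp_eq I G (u @ [(i, \<one>\<^bsub>G i\<^esub>)] @ v) (u @ v)"
| mult: "u \<in> fp_words I G \<Longrightarrow> v \<in> fp_words I G \<Longrightarrow> i \<in> I \<Longrightarrow>
     g \<in> carrier (G i) \<Longrightarrow> h \<in> carrier (G i) \<Longrightarrow>
     fp_eq I G (u @ [(i, g), (i, h)] @ v) (u @ [(i, g \<otimes>\<^bsub>G i\<^esub> h)] @ v)"

definition fp_class :: "'i set \<Rightarrow> ('i \<Rightarrow> 'g monoid) \<Rightarrow> ('i \<times> 'g) list \<Rightarrow> ('i \<times> 'g) list set" where
  "fp_class I G w = {w'. fp_eq I G w w'}"

definition free_product :: "'i set \<Rightarrow> ('i \<Rightarrow> 'g monoid) \<Rightarrow> ('i \<times> 'g) list set monoid" where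
  "free_product I G =
     \<lparr>carrier = fp_class I G ` fp_words I G,
      mult = (\<lambda>A B. \<Union>u\<in>A. \<Union>v\<in>B. fp_class I G (u @ v)),
      one = fp_class I G []\<rparr>"

definition fp_incl :: "'i set \<Rightarrow> ('i \<Rightarrow> 'g monoid) \<Rightarrow> 'i \<Rightarrow> 'g \<Rightarrow> ('i \<times> 'g) list set" where
  "fp_incl I G i g = fp_class I G [(i, g)]"

text \<open>The map into the free product of \<open>H\<close> over \<open>J\<close> induced by a map \<open>f\<close> on letters, which
  has to consist of a map \<open>\<phi> : I \<rightarrow> J\<close> and homomorphisms \<open>G i \<rightarrow> H (\<phi> i)\<close>.\<close>

definition fp_map ::
  "'j set \<Rightarrow> ('j \<Rightarrow> 'h monoid) \<Rightarrow> ('i \<times> 'g \<Rightarrow> 'j \<times> 'h) \<Rightarrow> ('i \<times> 'g) list set \<Rightarrow> ('j \<times> 'h) list set" where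
  "fp_map J H f A = (\<Union>w\<in>A. fp_class J H (map f w))"

text \<open>\<open>face S n i : S\<^sub>n \<rightarrow> S\<^sub>n\<^sub>-\<^sub>1\<close> (for \<open>n > 0\<close>) and \<open>degen S n i : S\<^sub>n \<rightarrow> S\<^sub>n\<^sub>+\<^sub>1\<close>, where \<open>i \<le> n\<close>.\<close>

record 'e sgrp =
  grp :: "nat \<Rightarrow> 'e monoid"
  face :: "nat \<Rightarrow> nat \<Rightarrow> 'e \<Rightarrow> 'e"
  degen :: "nat \<Rightarrow> nat \<Rightarrow> 'e \<Rightarrow> 'e"

definition sg_cycles :: "'e sgrp \<Rightarrow> nat \<Rightarrow> 'e set" where
  "sg_cycles S n = {x \<in> carrier (grp S n). 0 < n \<longrightarrow> (\<forall>i\<le>n. face S n i x = \<one>\<^bsub>grp S (n - 1)\<^esub>)}"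

definition sg_bounds :: "'e sgrp \<Rightarrow> nat \<Rightarrow> 'e set" where
  "sg_bounds S n =
     face S (Suc n) (Suc n) `
       {y \<in> carrier (grp S (Suc n)). \<forall>i\<le>n. face S (Suc n) i y = \<one>\<^bsub>grp S n\<^esub>}"

text \<open>The homotopy groups of a simplicial group, as the homology groups of its Moore complex
  \<open>N\<^sub>n = \<Inter>i<n. ker d\<^sup>i\<close> with boundary map the restriction of \<open>d\<^sup>n\<close>.\<close>

definition homotopy_group :: "'e sgrp \<Rightarrow> nat \<Rightarrow> 'e set monoid" where
  "homotopy_group S n = (grp S n\<lparr>carrier := sg_cycles S n\<rparr>) Mod (sg_bounds S n)"

text \<open>The map \<open>\<pi>\<^sub>n(S) \<rightarrow> \<pi>\<^sub>n(T)\<close> induced by the \<open>n\<close>-th component \<open>f\<close> of a simplicial homomorphism: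
  it sends the coset of \<open>x\<close> to the coset of \<open>f x\<close>.\<close>

definition homotopy_map :: "'f sgrp \<Rightarrow> nat \<Rightarrow> ('e \<Rightarrow> 'f) \<Rightarrow> 'e set \<Rightarrow> 'f set" where
  "homotopy_map T n f A = (\<Union>x\<in>A. sg_bounds T n #>\<^bsub>grp T n\<^esub> f x)"

fun composable :: "('o, 'a) cat \<Rightarrow> 'o \<Rightarrow> 'a list \<Rightarrow> bool" where
  "composable C c [] \<longleftrightarrow> True"
| "composable C c (\<alpha> # \<alpha>s) \<longleftrightarrow> \<alpha> \<in> Ar C \<and> Dom C \<alpha> = c \<and> composable C (Cod C \<alpha>) \<alpha>s"

text \<open>The \<open>n\<close>-simplex \<open>c\<^sub>0 \<rightarrow> \<dots> \<rightarrow> c\<^sub>n\<close> with arrows \<open>\<alpha>\<^sub>1, \<dots>, \<alpha>\<^sub>n\<close> of the nerve is the pair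
  \<open>(c\<^sub>0, [\<alpha>\<^sub>1, \<dots>, \<alpha>\<^sub>n])\<close>; note that \<open>\<alpha>\<^sub>i\<close> is the list entry with index \<open>i - 1\<close>.\<close>

definition nerve :: "('o, 'a) cat \<Rightarrow> nat \<Rightarrow> ('o \<times> 'a list) set" where
  "nerve C n = {(c, \<alpha>s). c \<in> Ob C \<and> length \<alpha>s = n \<and> composable C c \<alpha>s}"

definition vertex :: "('o, 'a) cat \<Rightarrow> nat \<Rightarrow> 'o \<times> 'a list \<Rightarrow> 'o" where
  "vertex C i = (\<lambda>(c, \<alpha>s). if i = 0 then c else Cod C (\<alpha>s ! (i - 1)))"

definition nerve_face :: "('o, 'a) cat \<Rightarrow> nat \<Rightarrow> 'o \<times> 'a list \<Rightarrow> 'o \<times> 'a list" where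
  "nerve_face C i = (\<lambda>(c, \<alpha>s).
     if i = 0 then (Cod C (hd \<alpha>s), tl \<alpha>s)
     else if i = length \<alpha>s then (c, butlast \<alpha>s)
     else (c, take (i - 1) \<alpha>s @ [Cmp C (\<alpha>s ! i) (\<alpha>s ! (i - 1))] @ drop (i + 1) \<alpha>s))"

definition nerve_degen :: "('o, 'a) cat \<Rightarrow> nat \<Rightarrow> 'o \<times> 'a list \<Rightarrow> 'o \<times> 'a list" where
  "nerve_degen C i = (\<lambda>(c, \<alpha>s). (c, take i \<alpha>s @ [Idn C (vertex C i (c, \<alpha>s))] @ drop i \<alpha>s))"

definition simplicial_replacement ::
  "('o, 'a) cat \<Rightarrow> ('o, 'a, 'g) grp_diag \<Rightarrow> (('o \<times> 'a list) \<times> 'g) list set sgrp" where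
  "simplicial_replacement C G =
     \<lparr>grp = (\<lambda>n. free_product (nerve C n) (\<lambda>s. gob G (fst s))),
      face = (\<lambda>n i. fp_map (nerve C (n - 1)) (\<lambda>s. gob G (fst s))
        (\<lambda>(s, x). (nerve_face C i s, if i = 0 then gar G (hd (snd s)) x else x))),
      degen = (\<lambda>n i. fp_map (nerve C (Suc n)) (\<lambda>s. gob G (fst s))
        (\<lambda>(s, x). (nerve_degen C i s, x)))\<rparr>"

definition colim_grp ::
  "('o, 'a) cat \<Rightarrow> ('o, 'a, 'g) grp_diag \<Rightarrow> nat \<Rightarrow> (('o \<times> 'a list) \<times> 'g) list set set monoid" where
  "colim_grp C G n = homotopy_group (simplicial_replacement C G) n"

text \<open>The homomorphism \<open>colim_grp C G n \<rightarrow> colim_grp C H n\<close> induced by \<open>\<theta> : G \<Rightarrow> H\<close>.\<close>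

definition colim_map ::
  "('o, 'a) cat \<Rightarrow> ('o, 'a, 'h) grp_diag \<Rightarrow> ('o \<Rightarrow> 'g \<Rightarrow> 'h) \<Rightarrow> nat \<Rightarrow>
   (('o \<times> 'a list) \<times> 'g) list set set \<Rightarrow> (('o \<times> 'a list) \<times> 'h) list set set" where
  "colim_map C H \<theta> n =
     homotopy_map (simplicial_replacement C H) n
       (fp_map (nerve C n) (\<lambda>s. gob H (fst s)) (\<lambda>(s, x). (s, \<theta> (fst s) x)))"

abbreviation Dset :: "('o, 'a) cat \<Rightarrow> ('o, 'a, 'x) set_diag \<Rightarrow> bool" where
  "Dset D X \<equiv> set_diagram (opcat D) X"

text \<open>The pair \<open>(\<alpha>, x)\<close> with \<open>\<alpha> : b \<rightarrow> a\<close> and \<open>x \<in> X(a)\<close> encodes the morphism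
  \<open>\<alpha> : (b, X(\<alpha>)(x)) \<rightarrow> (a, x)\<close> of the category of elements.\<close>

definition elements :: "('o, 'a) cat \<Rightarrow> ('o, 'a, 'x) set_diag \<Rightarrow> ('o \<times> 'x, 'a \<times> 'x) cat" where
  "elements D X =
     \<lparr>Ob = (SIGMA a:Ob D. sob X a),
      Ar = (SIGMA \<alpha>:Ar D. sob X (Cod D \<alpha>)),
      Dom = (\<lambda>(\<alpha>, x). (Dom D \<alpha>, sar X \<alpha> x)),
      Cod = (\<lambda>(\<alpha>, x). (Cod D \<alpha>, x)),
      Idn = (\<lambda>(a, x). (Idn D a, x)),
      Cmp = (\<lambda>(\<beta>, z) (\<alpha>, x). (Cmp D \<beta> \<alpha>, z))\<rparr>"

text \<open>The forgetful functor \<open>Q\<^sub>X\<close>; the same data also give the functor between the opposite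
  categories.\<close>

definition forget :: "('o \<times> 'x, 'a \<times> 'x, 'o, 'a) cfunctor" where
  "forget = \<lparr>fob = fst, far = fst\<rparr>"

text \<open>\<open>(L, \<eta>)\<close> is a left Kan extension of \<open>G\<close> along the opposite of \<open>Q\<^sub>X\<close>. The universal property
  is required for test diagrams of groups on two types: that of \<open>L\<close> itself and that of the free
  products of groups on \<open>'g\<close> over sets of elements of \<open>'x\<close>.\<close>

definition is_Lan ::
  "('o, 'a) cat \<Rightarrow> ('o, 'a, 'x) set_diag \<Rightarrow> ('o \<times> 'x, 'a \<times> 'x, 'g) grp_diag \<Rightarrow>
   ('o, 'a, 'l) grp_diag \<Rightarrow> ('o \<times> 'x \<Rightarrow> 'g \<Rightarrow> 'l) \<Rightarrow> bool" where
  "is_Lan D X G L \<eta> \<longleftrightarrow>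
     left_Kan TYPE('l) (opcat (elements D X)) (opcat D) forget G L \<eta> \<and>
     left_Kan TYPE(('x \<times> 'g) list set) (opcat (elements D X)) (opcat D) forget G L \<eta>"

text \<open>The homology \<open>H\<^sub>n(X, G)\<close> of a \<open>D\<close>-set, computed from a left Kan extension \<open>L\<close> of \<open>G\<close>.\<close>

definition Dset_homology ::
  "('o, 'a) cat \<Rightarrow> ('o, 'a, 'l) grp_diag \<Rightarrow> nat \<Rightarrow> (('o \<times> 'a list) \<times> 'l) list set set monoid" where
  "Dset_homology D L n = colim_grp (opcat D) L n"

definition chain_diag ::
  "('o, 'a) cat \<Rightarrow> ('o, 'a, 'x) set_diag \<Rightarrow> ('o \<times> 'x, 'a \<times> 'x, 'g) grp_diag \<Rightarrow>
   ('o, 'a, ('x \<times> 'g) list set) grp_diag" where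
  "chain_diag D X G =
     \<lparr>gob = (\<lambda>a. free_product (sob X a) (\<lambda>z. gob G (a, z))),
      gar = (\<lambda>\<alpha>. fp_map (sob X (Dom D \<alpha>)) (\<lambda>z. gob G (Dom D \<alpha>, z))
                    (\<lambda>(x, g). (sar X \<alpha> x, gar G (\<alpha>, x) g)))\<rparr>"

definition chain_unit ::
  "('o, 'a, 'x) set_diag \<Rightarrow> ('o \<times> 'x, 'a \<times> 'x, 'g) grp_diag \<Rightarrow> 'o \<times> 'x \<Rightarrow> 'g \<Rightarrow> ('x \<times> 'g) list set" where
  "chain_unit X G = (\<lambda>(a, x). fp_incl (sob X a) (\<lambda>z. gob G (a, z)) x)"

end

theory Submission
  imports Defs
begin

text \<open>The category of elements is a discrete fibration over \<open>D\<close>: an arrow \<open>\<alpha> : b \<rightarrow> a\<close> together with an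
  element \<open>x\<close> of \<open>X(a)\<close> is the same thing as an arrow of elements with target \<open>(a, x)\<close>. Both halves of
  the theorem come from this.

  A transformation of \<open>G\<close> into a diagram \<open>H\<close> pulled back along the forgetful functor is a family of
  homomorphisms \<open>G(a, x) \<rightarrow> H(a)\<close>, hence a homomorphism of the free product of the \<open>G(a, x)\<close> over
  \<open>x \<in> X(a)\<close> into \<open>H(a)\<close> for each \<open>a\<close>, and one may test naturality on the factors. So the free products form a
  left Kan extension (\<open>chain_left_Kan\<close>).

  A simplex of the nerve of the opposite category of elements is a simplex of the nerve of the opposite
  of \<open>D\<close>, starting at \<open>a\<close> say, together with an element of \<open>X(a)\<close>. Grouping the factors of
  the simplicial replacement of \<open>G\<close> by the underlying simplex turns its level \<open>n\<close> into the free product over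
  the \<open>n\<close>-simplices of the base of the groups \<open>L(a)\<close>, where \<open>L\<close> is the left Kan extension. The resulting
  map (\<open>replacement_map\<close>) is determined by the forgetful functor and the unit \<open>\<eta>\<close>, for every left Kan extension \<open>(L, \<eta>)\<close>,
  and this formula makes its compatibility with faces (\<open>replacement_face_map\<close>) and its naturality
  (\<open>homology_iso_natural\<close>) a matter of single letters. That it is bijective in every degree
  (\<open>comparison_bij\<close>) is seen by comparing \<open>L\<close> with the diagram of free products (\<open>chain_comparison\<close>).
  A levelwise bijective map of this kind induces isomorphisms of homotopy groups
  (\<open>homotopy_map_iso\<close>).\<close>

section \<open>Free products of groups\<close>

lemma fp_words_Nil [simp]: "[] \<in> fp_words I G"
  by (simp add: fp_words_def)

lemma fp_words_Cons [simp]: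
  "a # w \<in> fp_words I G \<longleftrightarrow> fst a \<in> I \<and> snd a \<in> carrier (G (fst a)) \<and> w \<in> fp_words I G"
  by (cases a) (auto simp: fp_words_def)

lemma fp_words_append [simp]:
  "u @ v \<in> fp_words I G \<longleftrightarrow> u \<in> fp_words I G \<and> v \<in> fp_words I G"
  by (auto simp: fp_words_def)

definition fp_eval :: "('k, 'm) monoid_scheme \<Rightarrow> ('i \<Rightarrow> 'g \<Rightarrow> 'k) \<Rightarrow> ('i \<times> 'g) list \<Rightarrow> 'k" where
  "fp_eval K \<phi> w = foldr (\<lambda>(i, g) y. \<phi> i g \<otimes>\<^bsub>K\<^esub> y) w \<one>\<^bsub>K\<^esub>"

text \<open>The homomorphism out of the free product whose restrictions to the factors are the \<open>\<phi> i\<close>.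
  Evaluation is constant on a class, so the image below is a singleton.\<close>

definition fp_lift :: "('k, 'm) monoid_scheme \<Rightarrow> ('i \<Rightarrow> 'g \<Rightarrow> 'k) \<Rightarrow> ('i \<times> 'g) list set \<Rightarrow> 'k" where
  "fp_lift K \<phi> A = the_elem (fp_eval K \<phi> ` A)"

text \<open>The condition on a letter map under which it respects the relations of the free product.\<close>

definition letter_hom ::
  "'i set \<Rightarrow> ('i \<Rightarrow> 'g monoid) \<Rightarrow> 'j set \<Rightarrow> ('j \<Rightarrow> 'h monoid) \<Rightarrow> ('i \<times> 'g \<Rightarrow> 'j \<times> 'h) \<Rightarrow> bool" where
  "letter_hom I G J H f \<longleftrightarrow>
     (\<forall>i\<in>I. \<exists>j\<in>J. \<exists>\<psi>\<in>hom (G i) (H j). \<forall>g\<in>carrier (G i). f (i, g) = (j, \<psi> g))"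

lemma letter_homI:
  assumes "\<And>i. i \<in> I \<Longrightarrow> \<phi> i \<in> J" and "\<And>i. i \<in> I \<Longrightarrow> \<psi> i \<in> hom (G i) (H (\<phi> i))"
    and "\<And>i g. i \<in> I \<Longrightarrow> g \<in> carrier (G i) \<Longrightarrow> f (i, g) = (\<phi> i, \<psi> i g)"
  shows "letter_hom I G J H f"
  using assms unfolding letter_hom_def by blast

locale group_family =
  fixes I :: "'i set" and G :: "'i \<Rightarrow> 'g monoid"
  assumes group_factor: "i \<in> I \<Longrightarrow> group (G i)"
begin

lemma one_factor [simp]: "i \<in> I \<Longrightarrow> \<one>\<^bsub>G i\<^esub> \<in> carrier (G i)"
  by (simp add: group.is_monoid group_factor monoid.one_closed)

lemma mult_factor [simp]:
  "i \<in> I \<Longrightarrow> g \<in> carrier (G i) \<Longrightarrow> h \<in> carrier (G i) \<Longrightarrow> g \<otimes>\<^bsub>G i\<^esub> h \<in> carrier (G i)"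
  by (simp add: group.is_monoid group_factor monoid.m_closed)

lemma fp_eq_words: "fp_eq I G v w \<Longrightarrow> v \<in> fp_words I G \<and> w \<in> fp_words I G"
  by (induction rule: fp_eq.induct) auto

lemma fp_eq_context:
  assumes "fp_eq I G v w" and "p \<in> fp_words I G" and "q \<in> fp_words I G"
  shows "fp_eq I G (p @ v @ q) (p @ w @ q)"
  using assms
proof (induction rule: fp_eq.induct)
  case (refl w)
  then show ?case by (auto intro: fp_eq.refl)
next
  case (sym v w)
  then show ?case by (auto intro: fp_eq.sym)
next
  case (trans u v w)
  then show ?case by (auto intro: fp_eq.trans)
next
  case (unit u v i)
  then show ?case using fp_eq.unit[of "p @ u" I G "v @ q" i] by simp
next
  case (mult u v i g h)
  then show ?case using fp_eq.mult[of "p @ u" I G "v @ q" i g h] by simp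
qed

lemma fp_eq_append:
  assumes "fp_eq I G u u'" and "fp_eq I G v v'"
  shows "fp_eq I G (u @ v) (u' @ v')"
proof -
  have "fp_eq I G (u @ v) (u' @ v)"
    using fp_eq_context[OF assms(1), of "[]" v] fp_eq_words[OF assms(2)] by simp
  moreover have "fp_eq I G (u' @ v) (u' @ v')"
    using fp_eq_context[OF assms(2), of u' "[]"] fp_eq_words[OF assms(1)] by simp
  ultimately show ?thesis by (rule fp_eq.trans)
qed

lemma fp_class_eqI: "fp_eq I G v w \<Longrightarrow> fp_class I G v = fp_class I G w"
  unfolding fp_class_def by (auto intro: fp_eq.sym fp_eq.trans)

lemma fp_class_self: "w \<in> fp_words I G \<Longrightarrow> w \<in> fp_class I G w"
  by (simp add: fp_class_def fp_eq.refl)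

lemma free_product_mult:
  assumes "u \<in> fp_words I G" and "v \<in> fp_words I G"
  shows "fp_class I G u \<otimes>\<^bsub>free_product I G\<^esub> fp_class I G v = fp_class I G (u @ v)"
proof -
  have eq: "fp_class I G (u' @ v') = fp_class I G (u @ v)"
    if "u' \<in> fp_class I G u" "v' \<in> fp_class I G v" for u' v'
  proof (rule fp_class_eqI[symmetric])
    show "fp_eq I G (u @ v) (u' @ v')"
      using that by (intro fp_eq_append) (auto simp: fp_class_def)
  qed
  have "fp_class I G u \<noteq> {}" "fp_class I G v \<noteq> {}"
    using fp_class_self[OF assms(1)] fp_class_self[OF assms(2)] by blast+
  then have "(\<Union>u'\<in>fp_class I G u. \<Union>v'\<in>fp_class I G v. fp_class I G (u' @ v')) =
      fp_class I G (u @ v)"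
    by (intro SUP_eq_const eq)
  then show ?thesis
    by (simp add: free_product_def)
qed

lemma free_product_carrier_cases:
  assumes "A \<in> carrier (free_product I G)"
  obtains w where "w \<in> fp_words I G" "A = fp_class I G w"
  using assms by (auto simp: free_product_def)

lemma fp_class_carrier [simp]:
  "w \<in> fp_words I G \<Longrightarrow> fp_class I G w \<in> carrier (free_product I G)"
  by (simp add: free_product_def)

lemma free_product_one: "\<one>\<^bsub>free_product I G\<^esub> = fp_class I G []"
  by (simp add: free_product_def)

text \<open>A left inverse of a word is built letter by letter: if \<open>v\<close> is one of \<open>w\<close>, then \<open>v\<close> followed by
  the inverse of \<open>g\<close> is one of \<open>g\<close> followed by \<open>w\<close>.\<close>

lemma fp_word_left_inverse:
  "w \<in> fp_words I G \<Longrightarrow> \<exists>v\<in>fp_words I G. fp_eq I G (v @ w) []"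
proof (induction w)
  case Nil
  have "fp_eq I G ([] @ []) []" by (simp add: fp_eq.refl)
  then show ?case by (rule bexI[OF _ fp_words_Nil])
next
  case (Cons a w)
  obtain i g where a: "a = (i, g)" by (cases a)
  have ig: "i \<in> I" "g \<in> carrier (G i)" "w \<in> fp_words I G" using Cons.prems a by auto
  from Cons.IH[OF ig(3)] obtain v where v: "v \<in> fp_words I G" "fp_eq I G (v @ w) []"
    by blast
  interpret Gi: group "G i" using group_factor ig by simp
  have 1: "fp_eq I G (v @ [(i, inv\<^bsub>G i\<^esub> g), (i, g)] @ w) (v @ [(i, \<one>\<^bsub>G i\<^esub>)] @ w)"
    using fp_eq.mult[OF v(1) ig(3,1) Gi.inv_closed[OF ig(2)] ig(2)] ig(2) by simp
  have 2: "fp_eq I G (v @ [(i, \<one>\<^bsub>G i\<^esub>)] @ w) (v @ w)"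
    using v(1) ig(3,1) by (rule fp_eq.unit)
  have "fp_eq I G (v @ [(i, inv\<^bsub>G i\<^esub> g), (i, g)] @ w) []"
    by (rule fp_eq.trans[OF fp_eq.trans[OF 1 2] v(2)])
  then have "fp_eq I G ((v @ [(i, inv\<^bsub>G i\<^esub> g)]) @ a # w) []"
    using a by simp
  moreover have "v @ [(i, inv\<^bsub>G i\<^esub> g)] \<in> fp_words I G" using v ig by simp
  ultimately show ?case by blast
qed

lemma free_product_group: "group (free_product I G)"
proof (rule groupI)
  fix A B assume "A \<in> carrier (free_product I G)" "B \<in> carrier (free_product I G)"
  then show "A \<otimes>\<^bsub>free_product I G\<^esub> B \<in> carrier (free_product I G)"
    by (auto elim!: free_product_carrier_cases simp: free_product_mult)
next
  show "\<one>\<^bsub>free_product I G\<^esub> \<in> carrier (free_product I G)"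
    by (simp add: free_product_one)
next
  fix A B C
  assume "A \<in> carrier (free_product I G)" "B \<in> carrier (free_product I G)"
    "C \<in> carrier (free_product I G)"
  then show "A \<otimes>\<^bsub>free_product I G\<^esub> B \<otimes>\<^bsub>free_product I G\<^esub> C =
      A \<otimes>\<^bsub>free_product I G\<^esub> (B \<otimes>\<^bsub>free_product I G\<^esub> C)"
    by (auto elim!: free_product_carrier_cases simp: free_product_mult)
next
  fix A assume "A \<in> carrier (free_product I G)"
  then show "\<one>\<^bsub>free_product I G\<^esub> \<otimes>\<^bsub>free_product I G\<^esub> A = A"
    by (auto elim!: free_product_carrier_cases simp: free_product_one free_product_mult)
next
  fix A assume "A \<in> carrier (free_product I G)"
  then obtain w where w: "w \<in> fp_words I G" "A = fp_class I G w"
    by (rule free_product_carrier_cases)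
  then obtain v where v: "v \<in> fp_words I G" "fp_eq I G (v @ w) []"
    using fp_word_left_inverse by blast
  then have "fp_class I G v \<otimes>\<^bsub>free_product I G\<^esub> A = \<one>\<^bsub>free_product I G\<^esub>"
    using w by (simp add: free_product_mult free_product_one fp_class_eqI)
  then show "\<exists>B\<in>carrier (free_product I G). B \<otimes>\<^bsub>free_product I G\<^esub> A = \<one>\<^bsub>free_product I G\<^esub>"
    using v(1) by (meson fp_class_carrier)
qed

lemma fp_incl_hom:
  assumes "i \<in> I"
  shows "fp_incl I G i \<in> hom (G i) (free_product I G)"
proof (rule homI)
  fix g h assume "g \<in> carrier (G i)" "h \<in> carrier (G i)"
  then have "fp_eq I G [(i, g), (i, h)] [(i, g \<otimes>\<^bsub>G i\<^esub> h)]"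
    using fp_eq.mult[of "[]" I G "[]" i g h] assms by simp
  then show "fp_incl I G i (g \<otimes>\<^bsub>G i\<^esub> h) =
      fp_incl I G i g \<otimes>\<^bsub>free_product I G\<^esub> fp_incl I G i h"
    using assms \<open>g \<in> carrier (G i)\<close> \<open>h \<in> carrier (G i)\<close>
    by (simp add: fp_incl_def free_product_mult fp_class_eqI)
qed (use assms in \<open>simp add: fp_incl_def\<close>)

lemma fp_incl_carrier [simp]:
  "i \<in> I \<Longrightarrow> g \<in> carrier (G i) \<Longrightarrow> fp_incl I G i g \<in> carrier (free_product I G)"
  by (simp add: fp_incl_def)

text \<open>The factors generate the free product.\<close>

lemma free_product_hom_eqI:
  assumes "group K" and f: "f \<in> hom (free_product I G) K" and f': "f' \<in> hom (free_product I G) K"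
    and eq: "\<And>i g. i \<in> I \<Longrightarrow> g \<in> carrier (G i) \<Longrightarrow> f (fp_incl I G i g) = f' (fp_incl I G i g)"
    and "A \<in> carrier (free_product I G)"
  shows "f A = f' A"
proof -
  have "f (fp_class I G w) = f' (fp_class I G w)" if "w \<in> fp_words I G" for w
    using that
  proof (induction w)
    case Nil
    then show ?case
      using hom_one[OF f free_product_group \<open>group K\<close>] hom_one[OF f' free_product_group \<open>group K\<close>]
      by (simp add: free_product_one)
  next
    case (Cons a w)
    obtain i g where a: "a = (i, g)" by (cases a)
    have *: "fp_class I G (a # w) = fp_incl I G i g \<otimes>\<^bsub>free_product I G\<^esub> fp_class I G w"
      using Cons.prems a by (simp add: fp_incl_def free_product_mult)
    show ?case
      using Cons a unfolding * by (simp add: hom_mult[OF f] hom_mult[OF f'] eq)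
  qed
  then show ?thesis using assms(5) by (auto elim: free_product_carrier_cases)
qed

context
  fixes K :: "('k, 'm) monoid_scheme" and \<phi> :: "'i \<Rightarrow> 'g \<Rightarrow> 'k"
  assumes K: "group K" and \<phi>: "\<And>i. i \<in> I \<Longrightarrow> \<phi> i \<in> hom (G i) K"
begin

interpretation K: group K by (rule K)

lemma fp_eval_carrier: "w \<in> fp_words I G \<Longrightarrow> fp_eval K \<phi> w \<in> carrier K"
  by (induction w) (auto simp: fp_eval_def intro!: K.m_closed hom_in_carrier[OF \<phi>])

lemma fp_eval_append:
  "u \<in> fp_words I G \<Longrightarrow> v \<in> fp_words I G \<Longrightarrow>
     fp_eval K \<phi> (u @ v) = fp_eval K \<phi> u \<otimes>\<^bsub>K\<^esub> fp_eval K \<phi> v"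
proof (induction u)
  case Nil
  then show ?case using fp_eval_carrier[of v] by (simp add: fp_eval_def)
next
  case (Cons a u)
  have eval_Cons: "fp_eval K \<phi> (a # w) = \<phi> (fst a) (snd a) \<otimes>\<^bsub>K\<^esub> fp_eval K \<phi> w" for w
    by (simp add: fp_eval_def case_prod_beta)
  show ?case
    using Cons fp_eval_carrier[of u] fp_eval_carrier[of v]
      hom_in_carrier[OF \<phi>, of "fst a" "snd a"]
    by (simp add: eval_Cons K.m_assoc)
qed

lemma fp_eval_eq: "fp_eq I G v w \<Longrightarrow> fp_eval K \<phi> v = fp_eval K \<phi> w"
proof (induction rule: fp_eq.induct)
  case (unit u v i)
  then have "fp_eval K \<phi> [(i, \<one>\<^bsub>G i\<^esub>)] = \<one>\<^bsub>K\<^esub>"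
    using hom_one[OF \<phi> group_factor K] by (simp add: fp_eval_def)
  with unit show ?case
    by (simp add: fp_eval_append fp_eval_carrier del: append_Cons append_Nil)
next
  case (mult u v i g h)
  then have "fp_eval K \<phi> [(i, g), (i, h)] = fp_eval K \<phi> [(i, g \<otimes>\<^bsub>G i\<^esub> h)]"
    using hom_mult[OF \<phi>] hom_in_carrier[OF \<phi>] by (simp add: fp_eval_def)
  with mult show ?case
    by (simp add: fp_eval_append del: append_Cons append_Nil)
qed auto

lemma fp_lift_class:
  assumes "w \<in> fp_words I G"
  shows "fp_lift K \<phi> (fp_class I G w) = fp_eval K \<phi> w"
proof -
  have "fp_eval K \<phi> ` fp_class I G w = {fp_eval K \<phi> w}"
    using fp_class_self[OF assms] unfolding fp_class_def by (auto dest: fp_eval_eq)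
  then show ?thesis by (simp add: fp_lift_def)
qed

lemma fp_lift_hom: "fp_lift K \<phi> \<in> hom (free_product I G) K"
  by (rule homI)
    (auto elim!: free_product_carrier_cases
      simp: fp_lift_class free_product_mult fp_eval_append fp_eval_carrier)

lemma fp_lift_incl:
  "i \<in> I \<Longrightarrow> g \<in> carrier (G i) \<Longrightarrow> fp_lift K \<phi> (fp_incl I G i g) = \<phi> i g"
  unfolding fp_incl_def using hom_in_carrier[OF \<phi>]
  by (subst fp_lift_class) (auto simp: fp_eval_def)

end

context
  fixes J :: "'j set" and H :: "'j \<Rightarrow> 'h monoid" and f :: "'i \<times> 'g \<Rightarrow> 'j \<times> 'h"
  assumes H: "group_family J H" and f: "letter_hom I G J H f"
begin

interpretation H: group_family J H by (rule H)

lemma letter_hom_words: "w \<in> fp_words I G \<Longrightarrow> map f w \<in> fp_words J H"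
proof (induction w)
  case (Cons a w)
  obtain i g where a: "a = (i, g)" by (cases a)
  then obtain j \<psi> where "j \<in> J" "\<psi> \<in> hom (G i) (H j)" "f a = (j, \<psi> g)"
    using f Cons.prems unfolding letter_hom_def by fastforce
  with Cons a show ?case by (auto simp: hom_in_carrier)
qed simp

lemma letter_hom_eq: "fp_eq I G v w \<Longrightarrow> fp_eq J H (map f v) (map f w)"
proof (induction rule: fp_eq.induct)
  case (refl w)
  then show ?case by (simp add: fp_eq.refl letter_hom_words)
next
  case (sym v w)
  then show ?case by (blast intro: fp_eq.sym)
next
  case (trans u v w)
  then show ?case by (blast intro: fp_eq.trans)
next
  case (unit u v i)
  then obtain j \<psi> where j: "j \<in> J" and \<psi>: "\<psi> \<in> hom (G i) (H j)"
    and eq: "\<And>g. g \<in> carrier (G i) \<Longrightarrow> f (i, g) = (j, \<psi> g)"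
    using f unfolding letter_hom_def by blast
  have "f (i, \<one>\<^bsub>G i\<^esub>) = (j, \<one>\<^bsub>H j\<^esub>)"
    using hom_one[OF \<psi>] unit j eq group_factor H.group_factor by simp
  then show ?case using fp_eq.unit[of "map f u" J H "map f v" j] j unit
    by (simp add: letter_hom_words)
next
  case (mult u v i g h)
  then obtain j \<psi> where j: "j \<in> J" and \<psi>: "\<psi> \<in> hom (G i) (H j)"
    and eq: "\<And>g. g \<in> carrier (G i) \<Longrightarrow> f (i, g) = (j, \<psi> g)"
    using f unfolding letter_hom_def by blast
  then show ?case
    using fp_eq.mult[of "map f u" J H "map f v" j "\<psi> g" "\<psi> h"] mult
    by (simp add: letter_hom_words hom_mult[OF \<psi>] hom_in_carrier[OF \<psi>])
qed

lemma fp_map_class: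
  assumes "w \<in> fp_words I G"
  shows "fp_map J H f (fp_class I G w) = fp_class J H (map f w)"
proof -
  have eq: "fp_class J H (map f w') = fp_class J H (map f w)" if "w' \<in> fp_class I G w" for w'
    using that letter_hom_eq[of w w'] H.fp_class_eqI[of "map f w" "map f w'"]
    by (simp add: fp_class_def)
  have "fp_class I G w \<noteq> {}"
    using fp_class_self[OF assms] by blast
  then show ?thesis
    unfolding fp_map_def by (intro SUP_eq_const eq)
qed

lemma fp_map_hom: "fp_map J H f \<in> hom (free_product I G) (free_product J H)"
  by (rule homI)
    (auto elim!: free_product_carrier_cases
      simp: fp_map_class letter_hom_words free_product_mult H.free_product_mult)

lemma fp_map_incl:
  assumes "i \<in> I" and "g \<in> carrier (G i)"
  shows "fp_map J H f (fp_incl I G i g) = fp_incl J H (fst (f (i, g))) (snd (f (i, g)))"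
  using assms by (simp add: fp_incl_def fp_map_class)

end

end

text \<open>Free products are functorial for letter maps, so a square of letter maps that commutes on
  letters commutes on free products.\<close>

lemma fp_map_square:
  assumes "group_family I G" "group_family J H" "group_family J' H'" "group_family K M"
    and f: "letter_hom I G J H f" and g: "letter_hom J H K M g"
    and f': "letter_hom I G J' H' f'" and g': "letter_hom J' H' K M g'"
    and eq: "\<And>i x. i \<in> I \<Longrightarrow> x \<in> carrier (G i) \<Longrightarrow> g (f (i, x)) = g' (f' (i, x))"
    and "A \<in> carrier (free_product I G)"
  shows "fp_map K M g (fp_map J H f A) = fp_map K M g' (fp_map J' H' f' A)"
proof -
  interpret I: group_family I G by fact
  interpret J: group_family J H by fact
  interpret J': group_family J' H' by fact
  obtain w where w: "w \<in> fp_words I G" "A = fp_class I G w"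
    using \<open>A \<in> _\<close> by (rule I.free_product_carrier_cases)
  have "map g (map f w) = map g' (map f' w)"
    using w(1) eq by (auto simp: fp_words_def)
  then show ?thesis
    unfolding w(2)
    by (simp only: I.fp_map_class[OF assms(2) f w(1)] I.fp_map_class[OF assms(3) f' w(1)]
      J.fp_map_class[OF assms(4) g I.letter_hom_words[OF assms(2) f w(1)]]
      J'.fp_map_class[OF assms(4) g' I.letter_hom_words[OF assms(3) f' w(1)]])
qed

section \<open>Homotopy groups and levelwise homomorphisms\<close>

text \<open>The part of a simplicial group that enters its homotopy groups: the groups and the faces.\<close>

locale face_system =
  fixes S :: "'e sgrp"
  assumes level_group: "group (grp S n)"
    and face_hom: "i \<le> Suc n \<Longrightarrow> face S (Suc n) i \<in> hom (grp S (Suc n)) (grp S n)"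
begin

lemma face_group_hom: "i \<le> Suc n \<Longrightarrow> group_hom (grp S (Suc n)) (grp S n) (face S (Suc n) i)"
  by (intro group_hom.intro group_hom_axioms.intro level_group face_hom)

text \<open>The boundaries are the image, under the last face, of an intersection of kernels.\<close>

lemma bounds_subgroup: "subgroup (sg_bounds S n) (grp S n)"
proof -
  interpret last: group_hom "grp S (Suc n)" "grp S n" "face S (Suc n) (Suc n)"
    by (rule face_group_hom) simp
  have "subgroup {y \<in> carrier (grp S (Suc n)). \<forall>i\<le>n. face S (Suc n) i y = \<one>\<^bsub>grp S n\<^esub>} (grp S (Suc n))"
  proof (rule last.G.subgroupI)
    show "{y \<in> carrier (grp S (Suc n)). \<forall>i\<le>n. face S (Suc n) i y = \<one>\<^bsub>grp S n\<^esub>} \<noteq> {}"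
      using group_hom.hom_one[OF face_group_hom] by (auto intro!: exI[of _ "\<one>\<^bsub>grp S (Suc n)\<^esub>"])
  qed (use group_hom.hom_inv[OF face_group_hom] hom_mult[OF face_hom] in auto)
  then show ?thesis
    unfolding sg_bounds_def by (rule last.subgroup_img_is_subgroup)
qed

lemma cycles_subset: "sg_cycles S n \<subseteq> carrier (grp S n)"
  by (auto simp: sg_cycles_def)

lemma homotopy_group_carrier:
  "carrier (homotopy_group S n) = (\<lambda>a. sg_bounds S n #>\<^bsub>grp S n\<^esub> a) ` sg_cycles S n"
  by (auto simp: homotopy_group_def FactGroup_def RCOSETS_def r_coset_def)

lemma homotopy_group_mult:
  "A \<otimes>\<^bsub>homotopy_group S n\<^esub> B = A <#>\<^bsub>grp S n\<^esub> B"
  by (simp add: homotopy_group_def FactGroup_def set_mult_def)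

end

locale face_map = S: face_system S + T: face_system T
  for S :: "'e sgrp" and T :: "'f sgrp" +
  fixes f :: "nat \<Rightarrow> 'e \<Rightarrow> 'f"
  assumes level_hom: "f n \<in> hom (grp S n) (grp T n)"
    and level_face: "i \<le> Suc n \<Longrightarrow> x \<in> carrier (grp S (Suc n)) \<Longrightarrow>
      f n (face S (Suc n) i x) = face T (Suc n) i (f (Suc n) x)"
begin

lemma level_group_hom: "group_hom (grp S n) (grp T n) (f n)"
  by (intro group_hom.intro group_hom_axioms.intro S.level_group T.level_group level_hom)

lemma level_one [simp]: "f n \<one>\<^bsub>grp S n\<^esub> = \<one>\<^bsub>grp T n\<^esub>"
  by (rule group_hom.hom_one[OF level_group_hom])

lemma level_closed: "x \<in> carrier (grp S n) \<Longrightarrow> f n x \<in> carrier (grp T n)"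
  by (rule hom_in_carrier[OF level_hom])

lemma face_one_image:
  "i \<le> Suc n \<Longrightarrow> x \<in> carrier (grp S (Suc n)) \<Longrightarrow> face S (Suc n) i x = \<one>\<^bsub>grp S n\<^esub> \<Longrightarrow>
     face T (Suc n) i (f (Suc n) x) = \<one>\<^bsub>grp T n\<^esub>"
  by (metis level_face level_one)

lemma bounds_image: "f n ` sg_bounds S n \<subseteq> sg_bounds T n"
proof
  fix z assume "z \<in> f n ` sg_bounds S n"
  then obtain y where y: "y \<in> carrier (grp S (Suc n))" "\<And>i. i \<le> n \<Longrightarrow> face S (Suc n) i y = \<one>\<^bsub>grp S n\<^esub>"
    and z: "z = f n (face S (Suc n) (Suc n) y)"
    unfolding sg_bounds_def by blast
  have "z = face T (Suc n) (Suc n) (f (Suc n) y)"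
    using y(1) z by (simp add: level_face)
  moreover have "\<forall>i\<le>n. face T (Suc n) i (f (Suc n) y) = \<one>\<^bsub>grp T n\<^esub>"
    using y by (simp add: face_one_image)
  ultimately show "z \<in> sg_bounds T n"
    unfolding sg_bounds_def using level_closed[OF y(1)] by blast
qed

lemma cycles_image: "x \<in> sg_cycles S n \<Longrightarrow> f n x \<in> sg_cycles T n"
  by (cases n) (auto simp: sg_cycles_def level_closed face_one_image)

text \<open>The induced map is defined as a union over a coset; since \<open>f\<close> maps boundaries to boundaries, all
  terms of that union agree.\<close>

lemma homotopy_map_coset:
  assumes a: "a \<in> carrier (grp S n)"
  shows "homotopy_map T n (f n) (sg_bounds S n #>\<^bsub>grp S n\<^esub> a) = sg_bounds T n #>\<^bsub>grp T n\<^esub> f n a"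
proof -
  interpret S_n: group "grp S n" by (rule S.level_group)
  interpret T_n: group "grp T n" by (rule T.level_group)
  have "sg_bounds T n #>\<^bsub>grp T n\<^esub> f n x = sg_bounds T n #>\<^bsub>grp T n\<^esub> f n a"
    if x: "x \<in> sg_bounds S n #>\<^bsub>grp S n\<^esub> a" for x
  proof -
    obtain b where b: "b \<in> sg_bounds S n" "x = b \<otimes>\<^bsub>grp S n\<^esub> a"
      using x by (auto simp: r_coset_def)
    then have "f n x = f n b \<otimes>\<^bsub>grp T n\<^esub> f n a"
      using subgroup.mem_carrier[OF S.bounds_subgroup b(1)] a by (simp add: hom_mult[OF level_hom])
    then have "f n x \<in> sg_bounds T n #>\<^bsub>grp T n\<^esub> f n a"
      using b(1) bounds_image by (auto simp: r_coset_def)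
    then show ?thesis
      using T_n.repr_independence level_closed[OF a] T.bounds_subgroup by metis
  qed
  moreover have "sg_bounds S n #>\<^bsub>grp S n\<^esub> a \<noteq> {}"
    using S_n.rcos_self[OF a S.bounds_subgroup] by blast
  ultimately show ?thesis
    unfolding homotopy_map_def by (intro SUP_eq_const)
qed

text \<open>Every step of the construction of \<open>\<pi>\<^sub>n\<close> (kernels of faces, the image of the last face, cosets)
  uses only group structure and faces, and a levelwise isomorphism preserves these.\<close>

lemma homotopy_map_iso:
  assumes bij: "\<And>n. bij_betw (f n) (carrier (grp S n)) (carrier (grp T n))"
  shows "homotopy_map T n (f n) \<in> iso (homotopy_group S n) (homotopy_group T n)"
proof -
  interpret S_n: group "grp S n" by (rule S.level_group)
  interpret T_n: group "grp T n" by (rule T.level_group)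
  have inj: "inj_on (f m) (carrier (grp S m))" for m
    using bij by (rule bij_betw_imp_inj_on)
  have surj: "f m ` carrier (grp S m) = carrier (grp T m)" for m
    using bij by (rule bij_betw_imp_surj_on)
  have face_one: "face S (Suc m) i x = \<one>\<^bsub>grp S m\<^esub>"
    if "i \<le> Suc m" "x \<in> carrier (grp S (Suc m))"
      and "face T (Suc m) i (f (Suc m) x) = \<one>\<^bsub>grp T m\<^esub>" for m i x
  proof (rule inj_onD[OF inj])
    show "f m (face S (Suc m) i x) = f m \<one>\<^bsub>grp S m\<^esub>"
      using that by (simp add: level_face)
    show "face S (Suc m) i x \<in> carrier (grp S m)"
      by (rule hom_in_carrier[OF S.face_hom]) (use that in auto)
    show "\<one>\<^bsub>grp S m\<^esub> \<in> carrier (grp S m)"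
      using S.level_group by (simp add: group.is_monoid)
  qed
  have bounds: "f n ` sg_bounds S n = sg_bounds T n"
  proof
    show "sg_bounds T n \<subseteq> f n ` sg_bounds S n"
    proof
      fix z assume "z \<in> sg_bounds T n"
      then obtain y where y: "y \<in> carrier (grp T (Suc n))"
          "\<And>i. i \<le> n \<Longrightarrow> face T (Suc n) i y = \<one>\<^bsub>grp T n\<^esub>"
        and z: "z = face T (Suc n) (Suc n) y"
        unfolding sg_bounds_def by blast
      obtain x where x: "x \<in> carrier (grp S (Suc n))" "y = f (Suc n) x"
        using y(1) surj by blast
      have "\<forall>i\<le>n. face S (Suc n) i x = \<one>\<^bsub>grp S n\<^esub>"
        using x y(2) by (auto intro: face_one)
      then have "face S (Suc n) (Suc n) x \<in> sg_bounds S n"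
        unfolding sg_bounds_def using x(1) by blast
      moreover have "z = f n (face S (Suc n) (Suc n) x)"
        using x z by (simp add: level_face)
      ultimately show "z \<in> f n ` sg_bounds S n" by blast
    qed
  qed (rule bounds_image)
  have cycles: "f n ` sg_cycles S n = sg_cycles T n"
  proof
    show "sg_cycles T n \<subseteq> f n ` sg_cycles S n"
    proof
      fix z assume z: "z \<in> sg_cycles T n"
      then obtain x where x: "x \<in> carrier (grp S n)" "z = f n x"
        using surj[of n] by (auto simp: sg_cycles_def)
      then have "x \<in> sg_cycles S n"
        using z by (cases n) (auto simp: sg_cycles_def intro: face_one)
      with x show "z \<in> f n ` sg_cycles S n" by blast
    qed
  qed (use cycles_image in blast)
  have image_coset: "f n ` (sg_bounds S n #>\<^bsub>grp S n\<^esub> a) = sg_bounds T n #>\<^bsub>grp T n\<^esub> f n a"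
    if "a \<in> carrier (grp S n)" for a
  proof -
    have "f n ` (sg_bounds S n #>\<^bsub>grp S n\<^esub> a) = (\<lambda>b. f n b \<otimes>\<^bsub>grp T n\<^esub> f n a) ` sg_bounds S n"
      using that subgroup.mem_carrier[OF S.bounds_subgroup]
      by (auto simp: r_coset_def hom_mult[OF level_hom] image_iff)
    also have "\<dots> = sg_bounds T n #>\<^bsub>grp T n\<^esub> f n a"
      unfolding bounds[symmetric] by (auto simp: r_coset_def)
    finally show ?thesis .
  qed
  have coset_subset: "sg_bounds S n #>\<^bsub>grp S n\<^esub> a \<subseteq> carrier (grp S n)" if "a \<in> carrier (grp S n)" for a
    using that subgroup.subset[OF S.bounds_subgroup] by (simp add: S_n.r_coset_subset_G)
  \<comment> \<open>The product \<open>A B\<close> of cosets is handled as a set: its image under the induced map is the set of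
      boundaries times \<open>f(A) f(B)\<close>, and the coset \<open>f(A)\<close> absorbs the boundaries.\<close>
  have map_mult:
    "homotopy_map T n (f n) ((sg_bounds S n #>\<^bsub>grp S n\<^esub> a) <#>\<^bsub>grp S n\<^esub> (sg_bounds S n #>\<^bsub>grp S n\<^esub> b)) =
      (sg_bounds T n #>\<^bsub>grp T n\<^esub> f n a) <#>\<^bsub>grp T n\<^esub> (sg_bounds T n #>\<^bsub>grp T n\<^esub> f n b)"
    (is "homotopy_map T n (f n) (?A <#>\<^bsub>grp S n\<^esub> ?B) = ?A' <#>\<^bsub>grp T n\<^esub> ?B'")
    if a: "a \<in> carrier (grp S n)" and b: "b \<in> carrier (grp S n)" for a b
  proof -
    note A = coset_subset[OF a] and B = coset_subset[OF b]
    have T_bounds: "sg_bounds T n \<subseteq> carrier (grp T n)"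
      by (rule subgroup.subset[OF T.bounds_subgroup])
    have "homotopy_map T n (f n) (?A <#>\<^bsub>grp S n\<^esub> ?B) = sg_bounds T n <#>\<^bsub>grp T n\<^esub> (f n ` (?A <#>\<^bsub>grp S n\<^esub> ?B))"
      by (auto simp: homotopy_map_def r_coset_def set_mult_def)
    also have "f n ` (?A <#>\<^bsub>grp S n\<^esub> ?B) = f n ` ?A <#>\<^bsub>grp T n\<^esub> f n ` ?B"
    proof -
      have "f n (x \<otimes>\<^bsub>grp S n\<^esub> y) = f n x \<otimes>\<^bsub>grp T n\<^esub> f n y" if "x \<in> ?A" "y \<in> ?B" for x y
        using that A B by (intro hom_mult[OF level_hom]) auto
      then show ?thesis
        by (fastforce simp: set_mult_def image_iff)
    qed
    also have "\<dots> = ?A' <#>\<^bsub>grp T n\<^esub> ?B'"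
      using a b by (simp add: image_coset)
    also have "sg_bounds T n <#>\<^bsub>grp T n\<^esub> (?A' <#>\<^bsub>grp T n\<^esub> ?B') = (sg_bounds T n <#>\<^bsub>grp T n\<^esub> ?A') <#>\<^bsub>grp T n\<^esub> ?B'"
      using T_bounds level_closed[OF a] level_closed[OF b]
      by (intro T_n.set_mult_assoc[symmetric] T_n.r_coset_subset_G)
    also have "sg_bounds T n <#>\<^bsub>grp T n\<^esub> ?A' = ?A'"
      using T_bounds level_closed[OF a] T_n.setmult_rcos_assoc[of "sg_bounds T n" "sg_bounds T n" "f n a"]
      by (simp add: T_n.subgroup_mult_id[OF T.bounds_subgroup])
    finally show ?thesis .
  qed
  show ?thesis
    unfolding iso_def
  proof (intro CollectI conjI homI)
    fix A B assume "A \<in> carrier (homotopy_group S n)" "B \<in> carrier (homotopy_group S n)"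
    then obtain a b where "a \<in> sg_cycles S n" "A = sg_bounds S n #>\<^bsub>grp S n\<^esub> a"
        "b \<in> sg_cycles S n" "B = sg_bounds S n #>\<^bsub>grp S n\<^esub> b"
      by (auto simp: S.homotopy_group_carrier)
    moreover have "a \<in> carrier (grp S n)" "b \<in> carrier (grp S n)"
      using calculation S.cycles_subset by blast+
    ultimately show "homotopy_map T n (f n) (A \<otimes>\<^bsub>homotopy_group S n\<^esub> B) =
        homotopy_map T n (f n) A \<otimes>\<^bsub>homotopy_group T n\<^esub> homotopy_map T n (f n) B"
      by (simp add: S.homotopy_group_mult T.homotopy_group_mult map_mult homotopy_map_coset)
  next
    have map_image: "homotopy_map T n (f n) A = f n ` A" "A \<subseteq> carrier (grp S n)"
      if A: "A \<in> carrier (homotopy_group S n)" for A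
    proof -
      obtain a where "a \<in> carrier (grp S n)" "A = sg_bounds S n #>\<^bsub>grp S n\<^esub> a"
        using A S.cycles_subset by (auto simp: S.homotopy_group_carrier)
      then show "homotopy_map T n (f n) A = f n ` A" "A \<subseteq> carrier (grp S n)"
        by (simp_all only: homotopy_map_coset image_coset coset_subset)
    qed
    have map_cosets: "homotopy_map T n (f n) ` carrier (homotopy_group S n) = carrier (homotopy_group T n)"
    proof -
      have eq: "homotopy_map T n (f n) (sg_bounds S n #>\<^bsub>grp S n\<^esub> a) = sg_bounds T n #>\<^bsub>grp T n\<^esub> f n a"
        if "a \<in> sg_cycles S n" for a
        using that S.cycles_subset by (intro homotopy_map_coset) blast
      show ?thesis
        unfolding S.homotopy_group_carrier T.homotopy_group_carrier cycles[symmetric] image_image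
        by (intro image_cong HOL.refl eq)
    qed
    show "bij_betw (homotopy_map T n (f n)) (carrier (homotopy_group S n)) (carrier (homotopy_group T n))"
      unfolding bij_betw_def
    proof (intro conjI inj_onI map_cosets)
      fix A B
      assume "A \<in> carrier (homotopy_group S n)" "B \<in> carrier (homotopy_group S n)"
        and "homotopy_map T n (f n) A = homotopy_map T n (f n) B"
      then show "A = B"
        using map_image inj_on_image_eq_iff[OF inj[of n]] by metis
    qed
    show "homotopy_map T n (f n) A \<in> carrier (homotopy_group T n)"
      if "A \<in> carrier (homotopy_group S n)" for A
      using that map_cosets by blast
  qed
qed

end

section \<open>Functoriality of the simplicial replacement\<close>

lemma functor_ob: "is_functor A B F \<Longrightarrow> c \<in> Ob A \<Longrightarrow> fob F c \<in> Ob B"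
  by (simp add: is_functor_def)

lemma functor_ar:
  assumes "is_functor A B F" and "\<alpha> \<in> Ar A"
  shows "far F \<alpha> \<in> Ar B" and "Dom B (far F \<alpha>) = fob F (Dom A \<alpha>)"
    and "Cod B (far F \<alpha>) = fob F (Cod A \<alpha>)"
  using assms by (simp_all add: is_functor_def)

lemma functor_cmp:
  "is_functor A B F \<Longrightarrow> \<alpha> \<in> Ar A \<Longrightarrow> \<beta> \<in> Ar A \<Longrightarrow> Cod A \<alpha> = Dom A \<beta> \<Longrightarrow>
     far F (Cmp A \<beta> \<alpha>) = Cmp B (far F \<beta>) (far F \<alpha>)"
  by (simp add: is_functor_def)

lemma cmp_ar:
  assumes "category C" and "\<alpha> \<in> Ar C" and "\<beta> \<in> Ar C" and "Cod C \<alpha> = Dom C \<beta>"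
  shows "Cmp C \<beta> \<alpha> \<in> Ar C" and "Dom C (Cmp C \<beta> \<alpha>) = Dom C \<alpha>" and "Cod C (Cmp C \<beta> \<alpha>) = Cod C \<beta>"
  using assms by (simp_all add: category_def)

lemma nat_trans_hom: "nat_trans C G H \<theta> \<Longrightarrow> c \<in> Ob C \<Longrightarrow> \<theta> c \<in> hom (gob G c) (gob H c)"
  by (simp add: nat_trans_def)

lemma nat_trans_square:
  "nat_trans C G H \<theta> \<Longrightarrow> \<alpha> \<in> Ar C \<Longrightarrow> x \<in> carrier (gob G (Dom C \<alpha>)) \<Longrightarrow>
     \<theta> (Cod C \<alpha>) (gar G \<alpha> x) = gar H \<alpha> (\<theta> (Dom C \<alpha>) x)"
  by (simp add: nat_trans_def)

lemma diagram_group: "group_diagram C G \<Longrightarrow> c \<in> Ob C \<Longrightarrow> group (gob G c)"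
  by (simp add: group_diagram_def)

lemma diagram_hom:
  "group_diagram C G \<Longrightarrow> \<alpha> \<in> Ar C \<Longrightarrow> gar G \<alpha> \<in> hom (gob G (Dom C \<alpha>)) (gob G (Cod C \<alpha>))"
  by (simp add: group_diagram_def)

lemma diagram_category: "group_diagram C G \<Longrightarrow> category C"
  by (simp add: group_diagram_def)

lemma arrow_ends_ob:
  "category C \<Longrightarrow> \<alpha> \<in> Ar C \<Longrightarrow> Dom C \<alpha> \<in> Ob C \<and> Cod C \<alpha> \<in> Ob C"
  by (simp add: category_def)

text \<open>Splitting the list of arrows at the position of the face removes the index arithmetic from
  all later arguments about faces.\<close>

lemma nerve_face_cases [consumes 2, case_names first last inner]:
  assumes "s \<in> nerve C (Suc n)" and "i \<le> Suc n"
  obtains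
    (first) c \<alpha> q where "i = 0" "s = (c, \<alpha> # q)" "nerve_face C i s = (Cod C \<alpha>, q)"
  | (last) c p \<alpha> where "i = Suc (length p)" "s = (c, p @ [\<alpha>])" "nerve_face C i s = (c, p)"
  | (inner) c p \<alpha> \<beta> q where "i = Suc (length p)" "s = (c, p @ \<alpha> # \<beta> # q)"
      "nerve_face C i s = (c, p @ Cmp C \<beta> \<alpha> # q)"
proof -
  obtain c as where s: "s = (c, as)" and len: "length as = Suc n"
    using assms(1) by (auto simp: nerve_def)
  consider "i = 0" | "i = Suc n" | "0 < i" "i < Suc n"
    using assms(2) by linarith
  then show thesis
  proof cases
    case 1
    obtain \<alpha> q where "as = \<alpha> # q" using len by (cases as) auto
    with 1 s show thesis by (intro first) (auto simp: nerve_face_def)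
  next
    case 2
    obtain p \<alpha> where as: "as = p @ [\<alpha>]" using len by (cases as rule: rev_cases) auto
    with 2 s len show thesis by (intro last) (auto simp: nerve_face_def)
  next
    case 3
    define p where "p = take (i - 1) as"
    have as: "as = p @ as ! (i - 1) # as ! i # drop (Suc i) as"
      using 3 len id_take_nth_drop[of "i - 1" as] Cons_nth_drop_Suc[of i as] by (simp add: p_def)
    have "i = Suc (length p)" using 3 len by (simp add: p_def)
    moreover have "nerve_face C i s = (c, p @ Cmp C (as ! i) (as ! (i - 1)) # drop (Suc i) as)"
      using 3 len s by (simp add: nerve_face_def p_def)
    ultimately show thesis using inner s as by blast
  qed
qed

lemma composable_append:
  "composable C c (p @ q) \<longleftrightarrow> composable C c p \<and> composable C (if p = [] then c else Cod C (last p)) q"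
  by (induction p arbitrary: c) auto

lemma nerve_face_nerve:
  assumes "category C" and "s \<in> nerve C (Suc n)" and "i \<le> Suc n"
  shows "nerve_face C i s \<in> nerve C n"
  using assms(2,3)
proof (cases rule: nerve_face_cases)
  case (first c \<alpha> q)
  then show ?thesis using assms(2) arrow_ends_ob[OF assms(1), of \<alpha>] by (auto simp: nerve_def)
next
  case (last c p \<alpha>)
  then show ?thesis using assms(2) by (auto simp: nerve_def composable_append)
next
  case (inner c p \<alpha> \<beta> q)
  then show ?thesis using assms(2) cmp_ar[OF assms(1), of \<alpha> \<beta>]
    by (auto simp: nerve_def composable_append)
qed

definition nerve_map ::
  "('o, 'a, 'p, 'b) cfunctor \<Rightarrow> 'o \<times> 'a list \<Rightarrow> 'p \<times> 'b list" where
  "nerve_map F s = (fob F (fst s), map (far F) (snd s))"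

lemma nerve_map_nerve:
  assumes F: "is_functor A B F" and s: "s \<in> nerve A n"
  shows "nerve_map F s \<in> nerve B n"
proof -
  have "composable A c as \<Longrightarrow> composable B (fob F c) (map (far F) as)" for c as
    by (induction as arbitrary: c) (auto simp: functor_ar[OF F])
  then show ?thesis
    using s functor_ob[OF F] by (auto simp: nerve_def nerve_map_def)
qed

lemma nerve_map_face:
  assumes F: "is_functor A B F" and s: "s \<in> nerve A (Suc n)" and i: "i \<le> Suc n"
  shows "nerve_map F (nerve_face A i s) = nerve_face B i (nerve_map F s)"
  using s i
proof (cases rule: nerve_face_cases)
  case (first c \<alpha> q)
  then show ?thesis using s by (simp add: nerve_map_def nerve_face_def nerve_def functor_ar[OF F])
next
  case (last c p \<alpha>)
  then show ?thesis using s by (simp add: nerve_map_def nerve_face_def butlast_append)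
next
  case (inner c p \<alpha> \<beta> q)
  then show ?thesis
    using s functor_cmp[OF F, of \<alpha> \<beta>]
    by (simp add: nerve_map_def nerve_face_def nerve_def composable_append nth_append split: if_splits)
qed

text \<open>The map of simplicial replacements induced by a change of category \<open>F\<close> and a transformation
  \<open>\<eta> : G \<Rightarrow> L \<circ> F\<close> of coefficients. It covers both the comparison along the forgetful functor and, with \<open>F\<close> the
  identity, the maps \<open>colim_map\<close>.\<close>

definition replacement_map ::
  "('p, 'b) cat \<Rightarrow> ('o, 'a, 'p, 'b) cfunctor \<Rightarrow> ('p, 'b, 'l) grp_diag \<Rightarrow> ('o \<Rightarrow> 'g \<Rightarrow> 'l) \<Rightarrow> nat \<Rightarrow>
   (('o \<times> 'a list) \<times> 'g) list set \<Rightarrow> (('p \<times> 'b list) \<times> 'l) list set" where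
  "replacement_map B F L \<eta> n =
     fp_map (nerve B n) (\<lambda>s. gob L (fst s)) (\<lambda>(s, g). (nerve_map F s, \<eta> (fst s) g))"

lemma nerve_group_family:
  "group_diagram C G \<Longrightarrow> group_family (nerve C n) (\<lambda>s. gob G (fst s))"
  by (auto simp: group_family_def nerve_def intro: diagram_group)

lemma nerve_ob: "s \<in> nerve C n \<Longrightarrow> fst s \<in> Ob C"
  by (auto simp: nerve_def)

lemma face_letter_hom:
  assumes G: "group_diagram C G" and i: "i \<le> Suc n"
  shows "letter_hom (nerve C (Suc n)) (\<lambda>s. gob G (fst s)) (nerve C n) (\<lambda>s. gob G (fst s))
    (\<lambda>(s, x). (nerve_face C i s, if i = 0 then gar G (hd (snd s)) x else x))"
proof (rule letter_homI)
  fix s assume s: "s \<in> nerve C (Suc n)"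
  show "nerve_face C i s \<in> nerve C n"
    by (rule nerve_face_nerve[OF diagram_category[OF G] s i])
  show "(\<lambda>x. if i = 0 then gar G (hd (snd s)) x else x) \<in> hom (gob G (fst s)) (gob G (fst (nerve_face C i s)))"
    using s i
  proof (cases rule: nerve_face_cases)
    case (first c \<alpha> q)
    then show ?thesis using s diagram_hom[OF G, of \<alpha>] by (auto simp: nerve_def)
  qed (simp_all add: hom_def)
qed simp

lemma replacement_map_letter_hom:
  assumes F: "is_functor A B F" and \<eta>: "nat_trans A G (precomp L F) \<eta>"
  shows "letter_hom (nerve A n) (\<lambda>s. gob G (fst s)) (nerve B n) (\<lambda>s. gob L (fst s))
    (\<lambda>(s, g). (nerve_map F s, \<eta> (fst s) g))"
proof (rule letter_homI)
  fix s assume s: "s \<in> nerve A n"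
  show "nerve_map F s \<in> nerve B n"
    by (rule nerve_map_nerve[OF F s])
  show "\<eta> (fst s) \<in> hom (gob G (fst s)) (gob L (fst (nerve_map F s)))"
    using nat_trans_hom[OF \<eta> nerve_ob[OF s]] by (simp add: precomp_def nerve_map_def)
qed simp

lemma replacement_grp:
  "grp (simplicial_replacement C G) n = free_product (nerve C n) (\<lambda>s. gob G (fst s))"
  by (simp add: simplicial_replacement_def)

lemma replacement_face:
  "face (simplicial_replacement C G) (Suc n) i = fp_map (nerve C n) (\<lambda>s. gob G (fst s))
    (\<lambda>(s, x). (nerve_face C i s, if i = 0 then gar G (hd (snd s)) x else x))"
  by (simp add: simplicial_replacement_def)

lemma replacement_face_system:
  assumes "group_diagram C G"
  shows "face_system (simplicial_replacement C G)"
proof (rule face_system.intro)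
  interpret group_family "nerve C n" "\<lambda>s. gob G (fst s)" for n
    by (rule nerve_group_family[OF assms])
  show "group (grp (simplicial_replacement C G) n)" for n
    unfolding replacement_grp by (rule free_product_group)
  show "face (simplicial_replacement C G) (Suc n) i \<in>
      hom (grp (simplicial_replacement C G) (Suc n)) (grp (simplicial_replacement C G) n)"
    if "i \<le> Suc n" for i n
    unfolding replacement_grp replacement_face
    by (rule fp_map_hom[OF nerve_group_family[OF assms] face_letter_hom[OF assms that]])
qed

text \<open>Away from the first face this is functoriality of the nerve; at the first face, where the
  coefficients change, it is the naturality of \<open>\<eta>\<close>.\<close>

lemma replacement_face_map:
  assumes F: "is_functor A B F" and G: "group_diagram A G" and L: "group_diagram B L"
    and \<eta>: "nat_trans A G (precomp L F) \<eta>"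
  shows "face_map (simplicial_replacement A G) (simplicial_replacement B L) (replacement_map B F L \<eta>)"
proof (intro face_map.intro face_map_axioms.intro replacement_face_system G L)
  interpret group_family "nerve A n" "\<lambda>s. gob G (fst s)" for n
    by (rule nerve_group_family[OF G])
  fix n
  show "replacement_map B F L \<eta> n \<in> hom (grp (simplicial_replacement A G) n) (grp (simplicial_replacement B L) n)"
    unfolding replacement_grp replacement_map_def
    by (rule fp_map_hom[OF nerve_group_family[OF L] replacement_map_letter_hom[OF F \<eta>]])
  fix i y assume i: "i \<le> Suc n" and y: "y \<in> carrier (grp (simplicial_replacement A G) (Suc n))"
  show "replacement_map B F L \<eta> n (face (simplicial_replacement A G) (Suc n) i y) =
      face (simplicial_replacement B L) (Suc n) i (replacement_map B F L \<eta> (Suc n) y)"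
    unfolding replacement_face replacement_map_def
  proof (rule fp_map_square[OF nerve_group_family[OF G] nerve_group_family[OF G] nerve_group_family[OF L]
        nerve_group_family[OF L] face_letter_hom[OF G i] replacement_map_letter_hom[OF F \<eta>]
        replacement_map_letter_hom[OF F \<eta>] face_letter_hom[OF L i] _ y[unfolded replacement_grp]])
    fix s x assume s: "s \<in> nerve A (Suc n)" and x: "x \<in> carrier (gob G (fst s))"
    have "\<eta> (fst (nerve_face A i s)) (if i = 0 then gar G (hd (snd s)) x else x) =
        (if i = 0 then gar L (hd (snd (nerve_map F s))) (\<eta> (fst s) x) else \<eta> (fst s) x)"
      using s i
    proof (cases rule: nerve_face_cases)
      case (first c \<alpha> q)
      then show ?thesis
        using s x nat_trans_square[OF \<eta>, of \<alpha> x] by (simp add: nerve_def nerve_map_def precomp_def)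
    qed simp_all
    then show "(case case (s, x) of (s, x) \<Rightarrow> (nerve_face A i s, if i = 0 then gar G (hd (snd s)) x else x) of
          (s, g) \<Rightarrow> (nerve_map F s, \<eta> (fst s) g)) =
        (case case (s, x) of (s, g) \<Rightarrow> (nerve_map F s, \<eta> (fst s) g) of
          (s, x) \<Rightarrow> (nerve_face B i s, if i = 0 then gar L (hd (snd s)) x else x))"
      using nerve_map_face[OF F s i] by simp
  qed
qed

definition id_functor :: "('o, 'a, 'o, 'a) cfunctor" where
  "id_functor = \<lparr>fob = (\<lambda>c. c), far = (\<lambda>\<alpha>. \<alpha>)\<rparr>"

lemma id_functor: "category C \<Longrightarrow> is_functor C C id_functor"
  by (simp add: is_functor_def id_functor_def category_def)

lemma nat_trans_precomp_id: "nat_trans C G H \<theta> \<Longrightarrow> nat_trans C G (precomp H id_functor) \<theta>"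
  by (simp add: precomp_def id_functor_def nat_trans_def)

lemma colim_map_eq:
  "colim_map C H \<theta> n = homotopy_map (simplicial_replacement C H) n (replacement_map C id_functor H \<theta> n)"
  by (simp add: colim_map_def replacement_map_def nerve_map_def id_functor_def)

section \<open>The diagram of free products as a left Kan extension\<close>

lemma left_Kan_universal:
  fixes H :: "('p, 'b, 'h) grp_diag"
  assumes "left_Kan TYPE('h) A B F G L \<eta>" "group_diagram B H" "nat_trans A G (precomp H F) \<gamma>"
  shows "\<exists>\<sigma>. nat_trans B L H \<sigma> \<and>
      (\<forall>c\<in>Ob A. \<forall>x\<in>carrier (gob G c). \<sigma> (fob F c) (\<eta> c x) = \<gamma> c x) \<and>
      (\<forall>\<tau>. nat_trans B L H \<tau> \<and>
        (\<forall>c\<in>Ob A. \<forall>x\<in>carrier (gob G c). \<tau> (fob F c) (\<eta> c x) = \<gamma> c x) \<longrightarrow>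
        (\<forall>b\<in>Ob B. \<forall>y\<in>carrier (gob L b). \<tau> b y = \<sigma> b y))"
proof -
  have "\<forall>(H :: ('p, 'b, 'h) grp_diag) \<gamma>. group_diagram B H \<and> nat_trans A G (precomp H F) \<gamma> \<longrightarrow>
      (\<exists>\<sigma>. nat_trans B L H \<sigma> \<and>
        (\<forall>c\<in>Ob A. \<forall>x\<in>carrier (gob G c). \<sigma> (fob F c) (\<eta> c x) = \<gamma> c x) \<and>
        (\<forall>\<tau>. nat_trans B L H \<tau> \<and>
          (\<forall>c\<in>Ob A. \<forall>x\<in>carrier (gob G c). \<tau> (fob F c) (\<eta> c x) = \<gamma> c x) \<longrightarrow>
          (\<forall>b\<in>Ob B. \<forall>y\<in>carrier (gob L b). \<tau> b y = \<sigma> b y)))"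
    using assms(1) unfolding left_Kan_def by (elim conjE)
  from this[rule_format, OF conjI[OF assms(2,3)]] show ?thesis .
qed

lemma left_Kan_factor:
  fixes H :: "('p, 'b, 'h) grp_diag"
  assumes "left_Kan TYPE('h) A B F G L \<eta>" "group_diagram B H" "nat_trans A G (precomp H F) \<gamma>"
  obtains \<sigma> where "nat_trans B L H \<sigma>"
    "\<forall>c\<in>Ob A. \<forall>x\<in>carrier (gob G c). \<sigma> (fob F c) (\<eta> c x) = \<gamma> c x"
  using left_Kan_universal[OF assms] by (elim exE conjE)

lemma left_Kan_unique:
  fixes H :: "('p, 'b, 'h) grp_diag"
  assumes K: "left_Kan TYPE('h) A B F G L \<eta>" "group_diagram B H" "nat_trans A G (precomp H F) \<gamma>"
    and \<tau>: "nat_trans B L H \<tau>" "\<forall>c\<in>Ob A. \<forall>x\<in>carrier (gob G c). \<tau> (fob F c) (\<eta> c x) = \<gamma> c x"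
    and \<tau>': "nat_trans B L H \<tau>'" "\<forall>c\<in>Ob A. \<forall>x\<in>carrier (gob G c). \<tau>' (fob F c) (\<eta> c x) = \<gamma> c x"
    and b: "b \<in> Ob B" and y: "y \<in> carrier (gob L b)"
  shows "\<tau> b y = \<tau>' b y"
proof -
  obtain \<sigma> where \<sigma>: "\<forall>\<tau>. nat_trans B L H \<tau> \<and>
        (\<forall>c\<in>Ob A. \<forall>x\<in>carrier (gob G c). \<tau> (fob F c) (\<eta> c x) = \<gamma> c x) \<longrightarrow>
        (\<forall>b\<in>Ob B. \<forall>y\<in>carrier (gob L b). \<tau> b y = \<sigma> b y)"
    using left_Kan_universal[OF K] by (elim exE conjE)
  have "\<tau> b y = \<sigma> b y"
    by (rule mp[OF spec[OF \<sigma>] conjI[OF \<tau>], THEN bspec, OF b, THEN bspec, OF y])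
  moreover have "\<tau>' b y = \<sigma> b y"
    by (rule mp[OF spec[OF \<sigma>] conjI[OF \<tau>'], THEN bspec, OF b, THEN bspec, OF y])
  ultimately show ?thesis by simp
qed

locale element_coefficients =
  fixes D :: "('o, 'a) cat" and X :: "('o, 'a, 'x) set_diag"
    and G :: "('o \<times> 'x, 'a \<times> 'x, 'g) grp_diag"
  assumes X: "Dset D X" and G: "group_diagram (opcat (elements D X)) G"
begin

abbreviation elts :: "('o \<times> 'x, 'a \<times> 'x) cat" where
  "elts \<equiv> opcat (elements D X)"

lemma op_category: "category (opcat D)"
  using X by (simp add: set_diagram_def)

lemma D_ar: "\<alpha> \<in> Ar D \<Longrightarrow> Dom D \<alpha> \<in> Ob D \<and> Cod D \<alpha> \<in> Ob D"
  using op_category by (simp add: category_def opcat_def)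

lemma X_ar: "\<alpha> \<in> Ar D \<Longrightarrow> x \<in> sob X (Cod D \<alpha>) \<Longrightarrow> sar X \<alpha> x \<in> sob X (Dom D \<alpha>)"
  using X by (auto simp: set_diagram_def opcat_def)

lemma forget_functor: "is_functor elts (opcat D) forget"
  using diagram_category[OF G] op_category D_ar
  by (auto simp: is_functor_def forget_def opcat_def elements_def)

lemma G_group: "a \<in> Ob D \<Longrightarrow> x \<in> sob X a \<Longrightarrow> group (gob G (a, x))"
  using diagram_group[OF G, of "(a, x)"] by (simp add: opcat_def elements_def)

lemma G_hom:
  "\<alpha> \<in> Ar D \<Longrightarrow> x \<in> sob X (Cod D \<alpha>) \<Longrightarrow>
     gar G (\<alpha>, x) \<in> hom (gob G (Cod D \<alpha>, x)) (gob G (Dom D \<alpha>, sar X \<alpha> x))"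
  using diagram_hom[OF G, of "(\<alpha>, x)"] by (simp add: opcat_def elements_def)

lemma G_idn:
  "a \<in> Ob D \<Longrightarrow> x \<in> sob X a \<Longrightarrow> g \<in> carrier (gob G (a, x)) \<Longrightarrow> gar G (Idn D a, x) g = g"
  using G unfolding group_diagram_def by (auto simp: opcat_def elements_def)

lemma G_cmp:
  assumes "\<alpha> \<in> Ar D" "\<beta> \<in> Ar D" "Cod D \<beta> = Dom D \<alpha>" "x \<in> sob X (Cod D \<alpha>)"
    and "g \<in> carrier (gob G (Cod D \<alpha>, x))"
  shows "gar G (Cmp D \<alpha> \<beta>, x) g = gar G (\<beta>, sar X \<alpha> x) (gar G (\<alpha>, x) g)"
proof -
  have "\<forall>p\<in>Ar elts. \<forall>q\<in>Ar elts. Cod elts p = Dom elts q \<longrightarrow>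
      (\<forall>g\<in>carrier (gob G (Dom elts p)). gar G (Cmp elts q p) g = gar G q (gar G p g))"
    using G by (simp add: group_diagram_def)
  from bspec[OF bspec[OF this, of "(\<alpha>, x)"], of "(\<beta>, sar X \<alpha> x)"]
  show ?thesis using assms X_ar[of \<alpha> x] by (simp add: opcat_def elements_def)
qed

lemma fibre_family: "a \<in> Ob D \<Longrightarrow> group_family (sob X a) (\<lambda>z. gob G (a, z))"
  by (simp add: group_family_def G_group)

lemma chain_gob: "gob (chain_diag D X G) a = free_product (sob X a) (\<lambda>z. gob G (a, z))"
  by (simp add: chain_diag_def)

lemma chain_group: "a \<in> Ob D \<Longrightarrow> group (gob (chain_diag D X G) a)"
  unfolding chain_gob by (rule group_family.free_product_group[OF fibre_family])

lemma chain_letter_hom: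
  "\<alpha> \<in> Ar D \<Longrightarrow> letter_hom (sob X (Cod D \<alpha>)) (\<lambda>z. gob G (Cod D \<alpha>, z))
     (sob X (Dom D \<alpha>)) (\<lambda>z. gob G (Dom D \<alpha>, z)) (\<lambda>(x, g). (sar X \<alpha> x, gar G (\<alpha>, x) g))"
  by (rule letter_homI[where \<phi> = "sar X \<alpha>" and \<psi> = "\<lambda>x. gar G (\<alpha>, x)"]) (auto simp: X_ar G_hom)

lemma chain_gar_hom:
  assumes "\<alpha> \<in> Ar D"
  shows "gar (chain_diag D X G) \<alpha> \<in>
    hom (gob (chain_diag D X G) (Cod D \<alpha>)) (gob (chain_diag D X G) (Dom D \<alpha>))"
  using group_family.fp_map_hom[OF fibre_family fibre_family chain_letter_hom] assms D_ar
  by (simp add: chain_diag_def)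

lemma chain_gar_incl:
  assumes "\<alpha> \<in> Ar D" "x \<in> sob X (Cod D \<alpha>)" "g \<in> carrier (gob G (Cod D \<alpha>, x))"
  shows "gar (chain_diag D X G) \<alpha> (fp_incl (sob X (Cod D \<alpha>)) (\<lambda>z. gob G (Cod D \<alpha>, z)) x g) =
    fp_incl (sob X (Dom D \<alpha>)) (\<lambda>z. gob G (Dom D \<alpha>, z)) (sar X \<alpha> x) (gar G (\<alpha>, x) g)"
  using group_family.fp_map_incl[OF fibre_family fibre_family chain_letter_hom] assms D_ar
  by (simp add: chain_diag_def)

lemma chain_hom_eqI:
  assumes "a \<in> Ob D" "group K"
    and "f \<in> hom (gob (chain_diag D X G) a) K" "f' \<in> hom (gob (chain_diag D X G) a) K"
    and "\<And>x g. x \<in> sob X a \<Longrightarrow> g \<in> carrier (gob G (a, x)) \<Longrightarrow>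
      f (fp_incl (sob X a) (\<lambda>z. gob G (a, z)) x g) = f' (fp_incl (sob X a) (\<lambda>z. gob G (a, z)) x g)"
    and "A \<in> carrier (gob (chain_diag D X G) a)"
  shows "f A = f' A"
  using assms unfolding chain_gob
  by (intro group_family.free_product_hom_eqI[OF fibre_family, of a K f f' A])

lemma chain_group_diagram: "group_diagram (opcat D) (chain_diag D X G)"
proof -
  let ?C = "chain_diag D X G"
  have idn: "gar ?C (Idn D a) A = A" if a: "a \<in> Ob D" and A: "A \<in> carrier (gob ?C a)" for a A
  proof -
    have I: "Idn D a \<in> Ar D" "Cod D (Idn D a) = a" "Dom D (Idn D a) = a"
      using op_category a by (auto simp: category_def opcat_def)
    have X_idn: "sar X (Idn D a) x = x" if "x \<in> sob X a" for x
      using X a that by (simp add: set_diagram_def opcat_def)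
    show ?thesis
    proof (rule chain_hom_eqI[OF a chain_group[OF a] _ _ _ A])
      show "gar ?C (Idn D a) \<in> hom (gob ?C a) (gob ?C a)"
        using chain_gar_hom[OF I(1)] by (simp add: I)
      show "(\<lambda>A. A) \<in> hom (gob ?C a) (gob ?C a)" by (simp add: hom_def)
    qed (use chain_gar_incl[OF I(1)] a in \<open>simp add: I G_idn X_idn\<close>)
  qed
  have cmp: "gar ?C (Cmp D \<alpha> \<beta>) A = gar ?C \<beta> (gar ?C \<alpha> A)"
    if \<alpha>: "\<alpha> \<in> Ar D" and \<beta>: "\<beta> \<in> Ar D" and eq: "Cod D \<beta> = Dom D \<alpha>"
      and A: "A \<in> carrier (gob ?C (Cod D \<alpha>))" for \<alpha> \<beta> A
  proof -
    have c: "Cmp D \<alpha> \<beta> \<in> Ar D" "Cod D (Cmp D \<alpha> \<beta>) = Cod D \<alpha>" "Dom D (Cmp D \<alpha> \<beta>) = Dom D \<beta>"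
      using cmp_ar[OF op_category, of \<alpha> \<beta>] \<alpha> \<beta> eq by (simp_all add: opcat_def)
    have X_cmp: "sar X (Cmp D \<alpha> \<beta>) x = sar X \<beta> (sar X \<alpha> x)" if "x \<in> sob X (Cod D \<alpha>)" for x
      using X \<alpha> \<beta> eq that by (simp add: set_diagram_def opcat_def)
    have "gar ?C (Cmp D \<alpha> \<beta>) A = (gar ?C \<beta> \<circ> gar ?C \<alpha>) A"
    proof (rule chain_hom_eqI[OF _ chain_group _ _ _ A])
      show "gar ?C (Cmp D \<alpha> \<beta>) \<in> hom (gob ?C (Cod D \<alpha>)) (gob ?C (Dom D \<beta>))"
        using chain_gar_hom[OF c(1)] by (simp add: c)
      show "gar ?C \<beta> \<circ> gar ?C \<alpha> \<in> hom (gob ?C (Cod D \<alpha>)) (gob ?C (Dom D \<beta>))"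
        using hom_compose[OF chain_gar_hom[OF \<alpha>]] chain_gar_hom[OF \<beta>] eq by simp
      fix x g assume x: "x \<in> sob X (Cod D \<alpha>)" and g: "g \<in> carrier (gob G (Cod D \<alpha>, x))"
      then show "gar ?C (Cmp D \<alpha> \<beta>) (fp_incl (sob X (Cod D \<alpha>)) (\<lambda>z. gob G (Cod D \<alpha>, z)) x g) =
          (gar ?C \<beta> \<circ> gar ?C \<alpha>) (fp_incl (sob X (Cod D \<alpha>)) (\<lambda>z. gob G (Cod D \<alpha>, z)) x g)"
        using chain_gar_incl[OF c(1)] chain_gar_incl[OF \<alpha> x g] chain_gar_incl[OF \<beta>]
          X_ar[OF \<alpha> x] hom_in_carrier[OF G_hom[OF \<alpha> x] g] \<alpha> \<beta> eq
        by (simp add: c G_cmp X_cmp)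
    qed (use D_ar \<alpha> \<beta> in auto)
    then show ?thesis by simp
  qed
  show ?thesis
    unfolding group_diagram_def
    using op_category chain_group chain_gar_hom idn cmp by (simp add: opcat_def)
qed

lemma chain_unit_nat_trans: "nat_trans elts G (precomp (chain_diag D X G) forget) (chain_unit X G)"
  unfolding nat_trans_def precomp_def forget_def
  using group_family.fp_incl_hom[OF fibre_family] chain_gar_incl
  by (auto simp: opcat_def elements_def chain_unit_def chain_gob)

text \<open>An arrow of the base with an element over its codomain lifts uniquely to an arrow of elements,
  so a transformation of \<open>G\<close> into a diagram pulled back along the forgetful functor amounts to
  homomorphisms out of the free products over the sets \<open>X(a)\<close>. Both their naturality and their uniqueness
  hold because the factors generate.\<close>

lemma chain_left_Kan:
  "left_Kan TYPE('h) elts (opcat D) forget G (chain_diag D X G) (chain_unit X G)"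
  unfolding left_Kan_def
proof (intro conjI allI impI forget_functor G chain_group_diagram chain_unit_nat_trans)
  fix H :: "('o, 'a, 'h) grp_diag" and \<gamma> :: "'o \<times> 'x \<Rightarrow> 'g \<Rightarrow> 'h"
  assume "group_diagram (opcat D) H \<and> nat_trans elts G (precomp H forget) \<gamma>"
  then have H: "group_diagram (opcat D) H" and \<gamma>: "nat_trans elts G (precomp H forget) \<gamma>" by auto
  let ?C = "chain_diag D X G"
  let ?incl = "\<lambda>a. fp_incl (sob X a) (\<lambda>z. gob G (a, z))"
  define \<sigma> where "\<sigma> a = fp_lift (gob H a) (\<lambda>x. \<gamma> (a, x))" for a
  have H_group: "group (gob H a)" if "a \<in> Ob D" for a
    using diagram_group[OF H] that by (simp add: opcat_def)
  have H_hom: "gar H \<alpha> \<in> hom (gob H (Cod D \<alpha>)) (gob H (Dom D \<alpha>))" if "\<alpha> \<in> Ar D" for \<alpha>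
    using diagram_hom[OF H] that by (simp add: opcat_def)
  have \<gamma>_hom: "\<gamma> (a, x) \<in> hom (gob G (a, x)) (gob H a)" if "a \<in> Ob D" "x \<in> sob X a" for a x
    using nat_trans_hom[OF \<gamma>, of "(a, x)"] that by (simp add: opcat_def elements_def precomp_def forget_def)
  have \<gamma>_square: "\<gamma> (Dom D \<alpha>, sar X \<alpha> x) (gar G (\<alpha>, x) g) = gar H \<alpha> (\<gamma> (Cod D \<alpha>, x) g)"
    if "\<alpha> \<in> Ar D" "x \<in> sob X (Cod D \<alpha>)" "g \<in> carrier (gob G (Cod D \<alpha>, x))" for \<alpha> x g
    using nat_trans_square[OF \<gamma>, of "(\<alpha>, x)"] that
    by (simp add: opcat_def elements_def precomp_def forget_def)
  have \<sigma>_hom: "\<sigma> a \<in> hom (gob ?C a) (gob H a)" if "a \<in> Ob D" for a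
    unfolding \<sigma>_def chain_gob
    by (rule group_family.fp_lift_hom[OF fibre_family[OF that] H_group[OF that] \<gamma>_hom[OF that]])
  have \<sigma>_incl: "\<sigma> a (?incl a x g) = \<gamma> (a, x) g"
    if "a \<in> Ob D" "x \<in> sob X a" "g \<in> carrier (gob G (a, x))" for a x g
    unfolding \<sigma>_def
    by (rule group_family.fp_lift_incl[OF fibre_family[OF that(1)] H_group[OF that(1)] \<gamma>_hom[OF that(1)]])
      (use that in auto)
  have \<sigma>_square: "\<sigma> (Dom D \<alpha>) (gar ?C \<alpha> A) = gar H \<alpha> (\<sigma> (Cod D \<alpha>) A)"
    if \<alpha>: "\<alpha> \<in> Ar D" and A: "A \<in> carrier (gob ?C (Cod D \<alpha>))" for \<alpha> A
  proof -
    have ob: "Dom D \<alpha> \<in> Ob D" "Cod D \<alpha> \<in> Ob D" using D_ar[OF \<alpha>] by auto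
    have "(\<sigma> (Dom D \<alpha>) \<circ> gar ?C \<alpha>) A = (gar H \<alpha> \<circ> \<sigma> (Cod D \<alpha>)) A"
    proof (rule chain_hom_eqI[OF ob(2) H_group[OF ob(1)] _ _ _ A])
      show "\<sigma> (Dom D \<alpha>) \<circ> gar ?C \<alpha> \<in> hom (gob ?C (Cod D \<alpha>)) (gob H (Dom D \<alpha>))"
        by (rule hom_compose[OF chain_gar_hom[OF \<alpha>] \<sigma>_hom[OF ob(1)]])
      show "gar H \<alpha> \<circ> \<sigma> (Cod D \<alpha>) \<in> hom (gob ?C (Cod D \<alpha>)) (gob H (Dom D \<alpha>))"
        by (rule hom_compose[OF \<sigma>_hom[OF ob(2)] H_hom[OF \<alpha>]])
      fix x g assume x: "x \<in> sob X (Cod D \<alpha>)" and g: "g \<in> carrier (gob G (Cod D \<alpha>, x))"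
      show "(\<sigma> (Dom D \<alpha>) \<circ> gar ?C \<alpha>) (?incl (Cod D \<alpha>) x g) = (gar H \<alpha> \<circ> \<sigma> (Cod D \<alpha>)) (?incl (Cod D \<alpha>) x g)"
        using \<alpha> x g ob hom_in_carrier[OF G_hom[OF \<alpha> x] g]
        by (simp add: chain_gar_incl \<sigma>_incl X_ar \<gamma>_square)
    qed
    then show ?thesis by simp
  qed
  show "\<exists>\<sigma>. nat_trans (opcat D) ?C H \<sigma> \<and>
      (\<forall>c\<in>Ob elts. \<forall>x\<in>carrier (gob G c). \<sigma> (fob forget c) (chain_unit X G c x) = \<gamma> c x) \<and>
      (\<forall>\<tau>. nat_trans (opcat D) ?C H \<tau> \<and>
        (\<forall>c\<in>Ob elts. \<forall>x\<in>carrier (gob G c). \<tau> (fob forget c) (chain_unit X G c x) = \<gamma> c x) \<longrightarrow>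
        (\<forall>b\<in>Ob (opcat D). \<forall>y\<in>carrier (gob ?C b). \<tau> b y = \<sigma> b y))"
  proof (intro exI[of _ \<sigma>] conjI allI impI ballI)
    show "nat_trans (opcat D) ?C H \<sigma>"
      unfolding nat_trans_def using \<sigma>_hom \<sigma>_square by (simp add: opcat_def)
    show "\<sigma> (fob forget c) (chain_unit X G c g) = \<gamma> c g"
      if "c \<in> Ob elts" "g \<in> carrier (gob G c)" for c g
      using that by (auto simp: opcat_def elements_def forget_def chain_unit_def \<sigma>_incl)
    fix \<tau> b A
    assume \<tau>: "nat_trans (opcat D) ?C H \<tau> \<and>
        (\<forall>c\<in>Ob elts. \<forall>x\<in>carrier (gob G c). \<tau> (fob forget c) (chain_unit X G c x) = \<gamma> c x)"
      and "b \<in> Ob (opcat D)" and A: "A \<in> carrier (gob ?C b)"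
    then have b: "b \<in> Ob D" by (simp add: opcat_def)
    show "\<tau> b A = \<sigma> b A"
    proof (rule chain_hom_eqI[OF b H_group[OF b] _ \<sigma>_hom[OF b] _ A])
      show "\<tau> b \<in> hom (gob ?C b) (gob H b)"
        using nat_trans_hom[of "opcat D" ?C H \<tau> b] \<tau> b by (simp add: opcat_def)
      fix x g assume "x \<in> sob X b" "g \<in> carrier (gob G (b, x))"
      then show "\<tau> b (?incl b x g) = \<sigma> b (?incl b x g)"
        using bspec[OF bspec[OF conjunct2[OF \<tau>], of "(b, x)"], of g] b
        by (simp add: \<sigma>_incl opcat_def elements_def forget_def chain_unit_def)
    qed
  qed
qed

end

section \<open>Homology of a presheaf from its category of elements\<close>

text \<open>In the opposite of the category of elements the source of \<open>(\<alpha>, x)\<close> carries \<open>x\<close> and its target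
  carries \<open>X(\<alpha>)(x)\<close>, so a chain of arrows of the base and the element at its first vertex determine
  the elements at all other vertices.\<close>

fun lift_arrows :: "('o, 'a, 'x) set_diag \<Rightarrow> 'x \<Rightarrow> 'a list \<Rightarrow> ('a \<times> 'x) list" where
  "lift_arrows X x [] = []"
| "lift_arrows X x (\<alpha> # \<alpha>s) = (\<alpha>, x) # lift_arrows X (sar X \<alpha> x) \<alpha>s"

definition lift_simplex ::
  "('o, 'a, 'x) set_diag \<Rightarrow> 'o \<times> 'a list \<Rightarrow> 'x \<Rightarrow> ('o \<times> 'x) \<times> ('a \<times> 'x) list" where
  "lift_simplex X s x = ((fst s, x), lift_arrows X x (snd s))"

context element_coefficients
begin

lemma lift_simplex_nerve:
  assumes "s \<in> nerve (opcat D) n" and "x \<in> sob X (fst s)"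
  shows "lift_simplex X s x \<in> nerve elts n" and "nerve_map forget (lift_simplex X s x) = s"
proof -
  have "composable (opcat D) c \<alpha>s \<Longrightarrow> x \<in> sob X c \<Longrightarrow>
      composable elts (c, x) (lift_arrows X x \<alpha>s) \<and> length (lift_arrows X x \<alpha>s) = length \<alpha>s \<and>
      map fst (lift_arrows X x \<alpha>s) = \<alpha>s" for c x \<alpha>s
  proof (induction \<alpha>s arbitrary: c x)
    case (Cons \<alpha> \<alpha>s)
    then have "\<alpha> \<in> Ar D" "Cod D \<alpha> = c" "composable (opcat D) (Dom D \<alpha>) \<alpha>s" "sar X \<alpha> x \<in> sob X (Dom D \<alpha>)"
      using X_ar[of \<alpha> x] by (auto simp: opcat_def)
    with Cons.IH[of "Dom D \<alpha>" "sar X \<alpha> x"] Cons.prems show ?case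
      by (simp add: opcat_def elements_def)
  qed simp
  then show "lift_simplex X s x \<in> nerve elts n" "nerve_map forget (lift_simplex X s x) = s"
    using assms by (auto simp: nerve_def lift_simplex_def nerve_map_def forget_def opcat_def elements_def)
qed

lemma lift_simplex_forget:
  assumes "s \<in> nerve elts n"
  shows "lift_simplex X (nerve_map forget s) (snd (fst s)) = s"
proof -
  have "composable elts (c, x) ps \<Longrightarrow> lift_arrows X x (map fst ps) = ps" for c x ps
    by (induction ps arbitrary: c x) (auto simp: opcat_def elements_def)
  then show ?thesis
    using assms by (auto simp: nerve_def lift_simplex_def nerve_map_def forget_def)
qed

lemma nerve_elts_ob:
  assumes "s \<in> nerve elts n"
  shows "fst (fst s) \<in> Ob D" and "snd (fst s) \<in> sob X (fst (fst s))"
  using nerve_ob[OF assms] by (auto simp: opcat_def elements_def)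

lemma lift_letter_hom:
  assumes "s \<in> nerve (opcat D) n"
  shows "letter_hom (sob X (fst s)) (\<lambda>z. gob G (fst s, z)) (nerve elts n) (\<lambda>s. gob G (fst s))
    (\<lambda>(x, g). (lift_simplex X s x, g))"
  by (rule letter_homI[where \<phi> = "lift_simplex X s" and \<psi> = "\<lambda>_ g. g"])
    (auto simp: lift_simplex_nerve[OF assms], simp add: lift_simplex_def hom_def)

end

locale element_Lan = element_coefficients D X G
  for D :: "('o, 'a) cat" and X :: "('o, 'a, 'x) set_diag"
    and G :: "('o \<times> 'x, 'a \<times> 'x, 'g) grp_diag" +
  fixes L :: "('o, 'a, 'l) grp_diag" and \<eta> :: "'o \<times> 'x \<Rightarrow> 'g \<Rightarrow> 'l"
  assumes Lan: "is_Lan D X G L \<eta>"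
begin

lemma L: "group_diagram (opcat D) L"
  using Lan by (simp add: is_Lan_def left_Kan_def)

lemma \<eta>: "nat_trans elts G (precomp L forget) \<eta>"
  using Lan by (simp add: is_Lan_def left_Kan_def)

text \<open>Objectwise, \<open>L\<close> is a retract of the diagram of free products, compatibly with the units: the
  universal property of \<open>L\<close> gives \<open>\<sigma>\<close>, that of the free products gives \<open>\<tau>\<close>, and the uniqueness in
  the universal property of \<open>L\<close> makes the composite on \<open>L\<close> the identity.\<close>

lemma chain_comparison:
  obtains \<sigma> \<tau> where
    "\<And>a. a \<in> Ob D \<Longrightarrow> \<sigma> a \<in> hom (gob L a) (gob (chain_diag D X G) a)"
    "\<And>a. a \<in> Ob D \<Longrightarrow> \<tau> a \<in> hom (gob (chain_diag D X G) a) (gob L a)"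
    "\<And>a x g. a \<in> Ob D \<Longrightarrow> x \<in> sob X a \<Longrightarrow> g \<in> carrier (gob G (a, x)) \<Longrightarrow>
       \<sigma> a (\<eta> (a, x) g) = fp_incl (sob X a) (\<lambda>z. gob G (a, z)) x g"
    "\<And>a x g. a \<in> Ob D \<Longrightarrow> x \<in> sob X a \<Longrightarrow> g \<in> carrier (gob G (a, x)) \<Longrightarrow>
       \<tau> a (fp_incl (sob X a) (\<lambda>z. gob G (a, z)) x g) = \<eta> (a, x) g"
    "\<And>a l. a \<in> Ob D \<Longrightarrow> l \<in> carrier (gob L a) \<Longrightarrow> \<tau> a (\<sigma> a l) = l"
proof -
  let ?C = "chain_diag D X G" and ?u = "chain_unit X G"
  have K: "left_Kan TYPE(('x \<times> 'g) list set) elts (opcat D) forget G L \<eta>"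
    "left_Kan TYPE('l) elts (opcat D) forget G L \<eta>"
    using Lan by (simp_all add: is_Lan_def)
  obtain \<sigma> where \<sigma>: "nat_trans (opcat D) L ?C \<sigma>"
    and \<sigma>_\<eta>: "\<forall>c\<in>Ob elts. \<forall>g\<in>carrier (gob G c). \<sigma> (fst c) (\<eta> c g) = ?u c g"
    by (rule left_Kan_factor[OF K(1) chain_group_diagram chain_unit_nat_trans]) (rule that, auto simp: forget_def)
  obtain \<tau> where \<tau>: "nat_trans (opcat D) ?C L \<tau>"
    and \<tau>_u: "\<forall>c\<in>Ob elts. \<forall>g\<in>carrier (gob G c). \<tau> (fst c) (?u c g) = \<eta> c g"
    by (rule left_Kan_factor[OF chain_left_Kan L \<eta>]) (rule that, auto simp: forget_def)
  have id: "nat_trans (opcat D) L L (\<lambda>b l. l)"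
    by (simp add: nat_trans_def hom_def)
  have \<tau>\<sigma>: "nat_trans (opcat D) L L (\<lambda>b l. \<tau> b (\<sigma> b l))"
  proof -
    have "(\<lambda>l. \<tau> b (\<sigma> b l)) \<in> hom (gob L b) (gob L b)" if "b \<in> Ob (opcat D)" for b
      using hom_compose[OF nat_trans_hom[OF \<sigma> that] nat_trans_hom[OF \<tau> that]] by (simp add: comp_def)
    moreover have "\<tau> (Cod (opcat D) \<alpha>) (\<sigma> (Cod (opcat D) \<alpha>) (gar L \<alpha> l)) =
        gar L \<alpha> (\<tau> (Dom (opcat D) \<alpha>) (\<sigma> (Dom (opcat D) \<alpha>) l))"
      if "\<alpha> \<in> Ar (opcat D)" "l \<in> carrier (gob L (Dom (opcat D) \<alpha>))" for \<alpha> l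
      using nat_trans_square[OF \<sigma> that] nat_trans_square[OF \<tau> that(1)]
        hom_in_carrier[OF nat_trans_hom[OF \<sigma>] that(2)] arrow_ends_ob[OF op_category that(1)] by simp
    ultimately show ?thesis by (simp add: nat_trans_def)
  qed
  have \<tau>_\<sigma>: "\<tau> b (\<sigma> b l) = l" if "b \<in> Ob (opcat D)" "l \<in> carrier (gob L b)" for b l
    using \<sigma>_\<eta> \<tau>_u by (intro left_Kan_unique[OF K(2) L \<eta> \<tau>\<sigma> _ id _ that]) (auto simp: forget_def)
  show thesis
  proof (rule that[of \<sigma> \<tau>])
    fix a x g assume "a \<in> Ob D" "x \<in> sob X a" "g \<in> carrier (gob G (a, x))"
    then show "\<sigma> a (\<eta> (a, x) g) = fp_incl (sob X a) (\<lambda>z. gob G (a, z)) x g"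
      "\<tau> a (fp_incl (sob X a) (\<lambda>z. gob G (a, z)) x g) = \<eta> (a, x) g"
      using \<sigma>_\<eta>[rule_format, of "(a, x)" g] \<tau>_u[rule_format, of "(a, x)" g]
      by (simp_all add: opcat_def elements_def forget_def chain_unit_def)
  qed (use nat_trans_hom[OF \<sigma>] nat_trans_hom[OF \<tau>] \<tau>_\<sigma> in \<open>auto simp: opcat_def\<close>)
qed

abbreviation comparison ::
  "nat \<Rightarrow> ((('o \<times> 'x) \<times> ('a \<times> 'x) list) \<times> 'g) list set \<Rightarrow> (('o \<times> 'a list) \<times> 'l) list set" where
  "comparison \<equiv> replacement_map (opcat D) forget L \<eta>"

sublocale face_map "simplicial_replacement elts G" "simplicial_replacement (opcat D) L" comparison
  by (rule replacement_face_map[OF forget_functor G L \<eta>])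

text \<open>An \<open>n\<close>-simplex of the category of elements is a simplex \<open>s\<close> of the base, starting at \<open>a\<close> say,
  together with an element of \<open>X(a)\<close>. Grouping the factors by \<open>s\<close> turns the source into a free
  product of free products over the \<open>X(a)\<close>, that is, of the groups \<open>L(a)\<close>. The inverse sends the
  factor \<open>L(a)\<close> at \<open>s\<close> through \<open>\<sigma>\<close> to the free product over \<open>X(a)\<close> and lifts \<open>s\<close> at each element.\<close>

lemma comparison_bij:
  "bij_betw (comparison n) (carrier (grp (simplicial_replacement elts G) n))
     (carrier (grp (simplicial_replacement (opcat D) L) n))"
proof -
  obtain \<sigma> \<tau> where
    \<sigma>: "\<And>a. a \<in> Ob D \<Longrightarrow> \<sigma> a \<in> hom (gob L a) (gob (chain_diag D X G) a)"
    and \<tau>: "\<And>a. a \<in> Ob D \<Longrightarrow> \<tau> a \<in> hom (gob (chain_diag D X G) a) (gob L a)"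
    and \<sigma>_\<eta>: "\<And>a x g. a \<in> Ob D \<Longrightarrow> x \<in> sob X a \<Longrightarrow> g \<in> carrier (gob G (a, x)) \<Longrightarrow>
       \<sigma> a (\<eta> (a, x) g) = fp_incl (sob X a) (\<lambda>z. gob G (a, z)) x g"
    and \<tau>_incl: "\<And>a x g. a \<in> Ob D \<Longrightarrow> x \<in> sob X a \<Longrightarrow> g \<in> carrier (gob G (a, x)) \<Longrightarrow>
       \<tau> a (fp_incl (sob X a) (\<lambda>z. gob G (a, z)) x g) = \<eta> (a, x) g"
    and \<tau>_\<sigma>: "\<And>a l. a \<in> Ob D \<Longrightarrow> l \<in> carrier (gob L a) \<Longrightarrow> \<tau> a (\<sigma> a l) = l"
    by (rule chain_comparison) blast
  let ?GS = "\<lambda>s. gob G (fst s)" and ?LS = "\<lambda>s. gob L (fst s)"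
  let ?P = "free_product (nerve elts n) ?GS" and ?R = "free_product (nerve (opcat D) n) ?LS"
  interpret P: group_family "nerve elts n" ?GS by (rule nerve_group_family[OF G])
  interpret R: group_family "nerve (opcat D) n" ?LS by (rule nerve_group_family[OF L])
  have \<eta>_closed: "\<eta> (fst s) g \<in> carrier (gob L (fst (fst s)))"
    if "s \<in> nerve elts n" "g \<in> carrier (?GS s)" for s g
    using hom_in_carrier[OF nat_trans_hom[OF \<eta> nerve_ob[OF that(1)]] that(2)]
    by (simp add: precomp_def forget_def)
  define \<Lambda> where "\<Lambda> s = fp_map (nerve elts n) ?GS (\<lambda>(x, g). (lift_simplex X s x, g))" for s
  have ob: "fst s \<in> Ob D" if "s \<in> nerve (opcat D) n" for s
    using nerve_ob[OF that] by (simp add: opcat_def)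
  have \<Lambda>_hom: "\<Lambda> s \<in> hom (gob (chain_diag D X G) (fst s)) ?P" if s: "s \<in> nerve (opcat D) n" for s
    unfolding \<Lambda>_def chain_gob
    by (rule group_family.fp_map_hom[OF fibre_family[OF ob[OF s]] P.group_family_axioms lift_letter_hom[OF s]])
  have \<Lambda>_incl: "\<Lambda> s (fp_incl (sob X (fst s)) (\<lambda>z. gob G (fst s, z)) x g) =
      fp_incl (nerve elts n) ?GS (lift_simplex X s x) g"
    if s: "s \<in> nerve (opcat D) n" and "x \<in> sob X (fst s)" "g \<in> carrier (gob G (fst s, x))" for s x g
    unfolding \<Lambda>_def
    using group_family.fp_map_incl[OF fibre_family[OF ob[OF s]] P.group_family_axioms lift_letter_hom[OF s]] that(2,3)
    by simp
  have branch: "\<Lambda> s \<circ> \<sigma> (fst s) \<in> hom (?LS s) ?P" if s: "s \<in> nerve (opcat D) n" for s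
    by (rule hom_compose[OF \<sigma>[OF ob[OF s]] \<Lambda>_hom[OF s]])
  define \<Psi> where "\<Psi> = fp_lift ?P (\<lambda>s. \<Lambda> s \<circ> \<sigma> (fst s))"
  have \<Psi>_hom: "\<Psi> \<in> hom ?R ?P"
    unfolding \<Psi>_def by (rule R.fp_lift_hom[OF P.free_product_group branch])
  have \<Psi>_incl: "\<Psi> (fp_incl (nerve (opcat D) n) ?LS s l) = \<Lambda> s (\<sigma> (fst s) l)"
    if "s \<in> nerve (opcat D) n" "l \<in> carrier (?LS s)" for s l
    unfolding \<Psi>_def using R.fp_lift_incl[OF P.free_product_group branch that] by simp
  have comp_hom: "comparison n \<in> hom ?P ?R"
    using level_hom by (simp add: replacement_grp)
  have comp_incl: "comparison n (fp_incl (nerve elts n) ?GS s g) =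
      fp_incl (nerve (opcat D) n) ?LS (nerve_map forget s) (\<eta> (fst s) g)"
    if "s \<in> nerve elts n" "g \<in> carrier (?GS s)" for s g
    unfolding replacement_map_def
    using P.fp_map_incl[OF R.group_family_axioms replacement_map_letter_hom[OF forget_functor \<eta>] that] by simp
  have \<Psi>_comp: "(\<Psi> \<circ> comparison n) A = A" if A: "A \<in> carrier ?P" for A
  proof (rule P.free_product_hom_eqI[OF P.free_product_group _ _ _ A])
    show "\<Psi> \<circ> comparison n \<in> hom ?P ?P" by (rule hom_compose[OF comp_hom \<Psi>_hom])
    show "(\<lambda>A. A) \<in> hom ?P ?P" by (simp add: hom_def)
    fix s g assume s: "s \<in> nerve elts n" and g: "g \<in> carrier (?GS s)"
    obtain a x where ax: "fst s = (a, x)" by (cases "fst s")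
    have s': "nerve_map forget s \<in> nerve (opcat D) n" "fst (nerve_map forget s) = a"
      using nerve_map_nerve[OF forget_functor s] ax by (auto simp: nerve_map_def forget_def)
    have "(\<Psi> \<circ> comparison n) (fp_incl (nerve elts n) ?GS s g) = \<Lambda> (nerve_map forget s) (\<sigma> a (\<eta> (a, x) g))"
      using s g s' \<eta>_closed[OF s g] ax by (simp add: comp_incl \<Psi>_incl)
    also have "\<dots> = fp_incl (nerve elts n) ?GS (lift_simplex X (nerve_map forget s) x) g"
      using nerve_elts_ob[OF s] g ax s' \<Lambda>_incl[OF s'(1), of x g] by (simp add: \<sigma>_\<eta>)
    also have "lift_simplex X (nerve_map forget s) x = s"
      using lift_simplex_forget[OF s] ax by simp
    finally show "(\<Psi> \<circ> comparison n) (fp_incl (nerve elts n) ?GS s g) = fp_incl (nerve elts n) ?GS s g" .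
  qed
  have comp_\<Psi>: "(comparison n \<circ> \<Psi>) A = A" if A: "A \<in> carrier ?R" for A
  proof (rule R.free_product_hom_eqI[OF R.free_product_group _ _ _ A])
    show "comparison n \<circ> \<Psi> \<in> hom ?R ?R" by (rule hom_compose[OF \<Psi>_hom comp_hom])
    show "(\<lambda>A. A) \<in> hom ?R ?R" by (simp add: hom_def)
    fix s l assume s: "s \<in> nerve (opcat D) n" and l: "l \<in> carrier (?LS s)"
    let ?i = "fp_incl (nerve (opcat D) n) ?LS s"
    \<comment> \<open>Since \<open>l = \<tau> (\<sigma> l)\<close>, two homomorphisms on the free product over \<open>X(a)\<close> have to be compared,
        and there the elements of the factors suffice.\<close>
    have "(comparison n \<circ> \<Lambda> s) B = (?i \<circ> \<tau> (fst s)) B" if B: "B \<in> carrier (gob (chain_diag D X G) (fst s))" for B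
    proof (rule chain_hom_eqI[OF ob[OF s] R.free_product_group _ _ _ B])
      show "comparison n \<circ> \<Lambda> s \<in> hom (gob (chain_diag D X G) (fst s)) ?R"
        by (rule hom_compose[OF \<Lambda>_hom[OF s] comp_hom])
      show "?i \<circ> \<tau> (fst s) \<in> hom (gob (chain_diag D X G) (fst s)) ?R"
        by (rule hom_compose[OF \<tau>[OF ob[OF s]] R.fp_incl_hom[OF s]])
      fix x g assume x: "x \<in> sob X (fst s)" and g: "g \<in> carrier (gob G (fst s, x))"
      have "fst (lift_simplex X s x) = (fst s, x)" by (simp add: lift_simplex_def)
      then show "(comparison n \<circ> \<Lambda> s) (fp_incl (sob X (fst s)) (\<lambda>z. gob G (fst s, z)) x g) =
          (?i \<circ> \<tau> (fst s)) (fp_incl (sob X (fst s)) (\<lambda>z. gob G (fst s, z)) x g)"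
        using x g ob[OF s] lift_simplex_nerve[OF s x] by (simp add: \<Lambda>_incl[OF s x g] \<tau>_incl comp_incl)
    qed
    from this[of "\<sigma> (fst s) l"] show "(comparison n \<circ> \<Psi>) (?i l) = ?i l"
      using hom_in_carrier[OF \<sigma>[OF ob[OF s]] l] l by (simp add: \<Psi>_incl[OF s l] \<tau>_\<sigma>[OF ob[OF s]])
  qed
  show ?thesis
    unfolding replacement_grp
    by (rule bij_betwI[where g = \<Psi>]) (use comp_hom \<Psi>_hom \<Psi>_comp comp_\<Psi> in \<open>auto simp: hom_def\<close>)
qed

lemma homology_iso:
  "homotopy_map (simplicial_replacement (opcat D) L) n (comparison n) \<in>
     iso (colim_grp elts G n) (Dset_homology D L n)"
  unfolding colim_grp_def Dset_homology_def by (rule homotopy_map_iso[OF comparison_bij])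

end

text \<open>Both composites are induced by maps of free products, and on letters they agree by the
  compatibility of \<open>\<sigma>\<close> with the units.\<close>

lemma homology_iso_natural:
  assumes "element_Lan D X G L \<eta>" and "element_Lan D X G' L' \<eta>'"
    and \<theta>: "nat_trans (opcat (elements D X)) G G' \<theta>" and \<sigma>: "nat_trans (opcat D) L L' \<sigma>"
    and units: "\<And>a x g. (a, x) \<in> Ob (elements D X) \<Longrightarrow> g \<in> carrier (gob G (a, x)) \<Longrightarrow>
      \<sigma> a (\<eta> (a, x) g) = \<eta>' (a, x) (\<theta> (a, x) g)"
    and y: "y \<in> carrier (colim_grp (opcat (elements D X)) G n)"
  shows "homotopy_map (simplicial_replacement (opcat D) L') n (replacement_map (opcat D) forget L' \<eta>' n)
      (colim_map (opcat (elements D X)) G' \<theta> n y) =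
    colim_map (opcat D) L' \<sigma> n
      (homotopy_map (simplicial_replacement (opcat D) L) n (replacement_map (opcat D) forget L \<eta> n) y)"
proof -
  interpret L: element_Lan D X G L \<eta> by fact
  interpret L': element_Lan D X G' L' \<eta>' by fact
  let ?E = "opcat (elements D X)" and ?B = "opcat D"
  note \<theta>' = nat_trans_precomp_id[OF \<theta>] and \<sigma>' = nat_trans_precomp_id[OF \<sigma>]
  note id_E = id_functor[OF diagram_category[OF L.G]] and id_B = id_functor[OF L.op_category]
  interpret \<theta>: face_map "simplicial_replacement ?E G" "simplicial_replacement ?E G'"
      "replacement_map ?E id_functor G' \<theta>"
    by (rule replacement_face_map[OF id_E L.G L'.G \<theta>'])
  interpret \<sigma>: face_map "simplicial_replacement ?B L" "simplicial_replacement ?B L'"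
      "replacement_map ?B id_functor L' \<sigma>"
    by (rule replacement_face_map[OF id_B L.L L'.L \<sigma>'])
  obtain a where a: "a \<in> carrier (grp (simplicial_replacement ?E G) n)"
    and y: "y = sg_bounds (simplicial_replacement ?E G) n #>\<^bsub>grp (simplicial_replacement ?E G) n\<^esub> a"
    using y L.S.cycles_subset[of n] unfolding colim_grp_def L.S.homotopy_group_carrier by blast
  have "replacement_map ?B forget L' \<eta>' n (replacement_map ?E id_functor G' \<theta> n a) =
      replacement_map ?B id_functor L' \<sigma> n (replacement_map ?B forget L \<eta> n a)"
    unfolding replacement_map_def
  proof (rule fp_map_square[OF nerve_group_family[OF L.G] nerve_group_family[OF L'.G]
        nerve_group_family[OF L.L] nerve_group_family[OF L'.L]
        replacement_map_letter_hom[OF id_E \<theta>'] replacement_map_letter_hom[OF L'.forget_functor L'.\<eta>]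
        replacement_map_letter_hom[OF L.forget_functor L.\<eta>] replacement_map_letter_hom[OF id_B \<sigma>']
        _ a[unfolded replacement_grp]])
    fix s g assume "s \<in> nerve ?E n" and "g \<in> carrier (gob G (fst s))"
    then show "(case case (s, g) of (s, g) \<Rightarrow> (nerve_map id_functor s, \<theta> (fst s) g) of
          (s, g) \<Rightarrow> (nerve_map forget s, \<eta>' (fst s) g)) =
        (case case (s, g) of (s, g) \<Rightarrow> (nerve_map forget s, \<eta> (fst s) g) of
          (s, g) \<Rightarrow> (nerve_map id_functor s, \<sigma> (fst s) g))"
      using nerve_ob[of s ?E n] units[of "fst (fst s)" "snd (fst s)" g]
      by (simp add: nerve_map_def id_functor_def forget_def opcat_def)
  qed
  then show ?thesis
    unfolding colim_map_eq y
    by (simp add: L.homotopy_map_coset L'.homotopy_map_coset \<theta>.homotopy_map_coset \<sigma>.homotopy_map_coset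
        L.level_closed \<theta>.level_closed a)
qed

theorem proposition5p1:
  fixes D :: "('o, 'a) cat" and X :: "('o, 'a, 'x) set_diag"
  assumes "category D" and "Dset D X"
  shows
    "(\<exists>\<Phi> :: ('o \<times> 'x, 'a \<times> 'x, 'g) grp_diag \<Rightarrow> ('o, 'a, 'l) grp_diag \<Rightarrow> ('o \<times> 'x \<Rightarrow> 'g \<Rightarrow> 'l) \<Rightarrow> nat \<Rightarrow>
            ((('o \<times> 'x) \<times> ('a \<times> 'x) list) \<times> 'g) list set set \<Rightarrow> (('o \<times> 'a list) \<times> 'l) list set set.
        (\<forall>G L \<eta> n. group_diagram (opcat (elements D X)) G \<and> is_Lan D X G L \<eta> \<longrightarrow>
           \<Phi> G L \<eta> n \<in> iso (colim_grp (opcat (elements D X)) G n) (Dset_homology D L n)) \<and>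
        (\<forall>G L \<eta> G' L' \<eta>' \<theta> \<sigma> n.
           group_diagram (opcat (elements D X)) G \<and> is_Lan D X G L \<eta> \<and>
           group_diagram (opcat (elements D X)) G' \<and> is_Lan D X G' L' \<eta>' \<and>
           nat_trans (opcat (elements D X)) G G' \<theta> \<and> nat_trans (opcat D) L L' \<sigma> \<and>
           (\<forall>(a, x)\<in>Ob (elements D X). \<forall>g\<in>carrier (gob G (a, x)).
              \<sigma> a (\<eta> (a, x) g) = \<eta>' (a, x) (\<theta> (a, x) g)) \<longrightarrow>
           (\<forall>y\<in>carrier (colim_grp (opcat (elements D X)) G n).
              \<Phi> G' L' \<eta>' n (colim_map (opcat (elements D X)) G' \<theta> n y) =
              colim_map (opcat D) L' \<sigma> n (\<Phi> G L \<eta> n y)))) \<and>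
     (\<forall>G :: ('o \<times> 'x, 'a \<times> 'x, 'g) grp_diag. group_diagram (opcat (elements D X)) G \<longrightarrow>
        left_Kan TYPE('h) (opcat (elements D X)) (opcat D) forget G (chain_diag D X G) (chain_unit X G) \<and>
        (\<forall>a\<in>Ob D. gob (chain_diag D X G) a = free_product (sob X a) (\<lambda>z. gob G (a, z))) \<and>
        (\<forall>\<alpha>\<in>Ar D. \<forall>x\<in>sob X (Cod D \<alpha>). \<forall>g\<in>carrier (gob G (Cod D \<alpha>, x)).
           gar (chain_diag D X G) \<alpha> (fp_incl (sob X (Cod D \<alpha>)) (\<lambda>z. gob G (Cod D \<alpha>, z)) x g) =
           fp_incl (sob X (Dom D \<alpha>)) (\<lambda>z. gob G (Dom D \<alpha>, z)) (sar X \<alpha> x) (gar G (\<alpha>, x) g)))"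
proof (intro conjI allI impI)
  show "\<exists>\<Phi> :: ('o \<times> 'x, 'a \<times> 'x, 'g) grp_diag \<Rightarrow> ('o, 'a, 'l) grp_diag \<Rightarrow> ('o \<times> 'x \<Rightarrow> 'g \<Rightarrow> 'l) \<Rightarrow> nat \<Rightarrow>
            ((('o \<times> 'x) \<times> ('a \<times> 'x) list) \<times> 'g) list set set \<Rightarrow> (('o \<times> 'a list) \<times> 'l) list set set.
        (\<forall>G L \<eta> n. group_diagram (opcat (elements D X)) G \<and> is_Lan D X G L \<eta> \<longrightarrow>
           \<Phi> G L \<eta> n \<in> iso (colim_grp (opcat (elements D X)) G n) (Dset_homology D L n)) \<and>
        (\<forall>G L \<eta> G' L' \<eta>' \<theta> \<sigma> n.
           group_diagram (opcat (elements D X)) G \<and> is_Lan D X G L \<eta> \<and>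
           group_diagram (opcat (elements D X)) G' \<and> is_Lan D X G' L' \<eta>' \<and>
           nat_trans (opcat (elements D X)) G G' \<theta> \<and> nat_trans (opcat D) L L' \<sigma> \<and>
           (\<forall>(a, x)\<in>Ob (elements D X). \<forall>g\<in>carrier (gob G (a, x)).
              \<sigma> a (\<eta> (a, x) g) = \<eta>' (a, x) (\<theta> (a, x) g)) \<longrightarrow>
           (\<forall>y\<in>carrier (colim_grp (opcat (elements D X)) G n).
              \<Phi> G' L' \<eta>' n (colim_map (opcat (elements D X)) G' \<theta> n y) =
              colim_map (opcat D) L' \<sigma> n (\<Phi> G L \<eta> n y)))"
  proof (intro exI[of _ "\<lambda>G L \<eta> n. homotopy_map (simplicial_replacement (opcat D) L) n
      (replacement_map (opcat D) forget L \<eta> n)"] conjI allI impI ballI, goal_cases)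
    case (1 G L \<eta> n)
    then interpret element_Lan D X G L \<eta>
      using assms by unfold_locales auto
    show ?case by (rule homology_iso)
  next
    case (2 G L \<eta> G' L' \<eta>' \<theta> \<sigma> n y)
    then have "element_Lan D X G L \<eta>" "element_Lan D X G' L' \<eta>'"
      using assms by (simp_all add: element_Lan_def element_Lan_axioms_def element_coefficients_def)
    with 2 show ?case by (intro homology_iso_natural) auto
  qed
next
  fix G :: "('o \<times> 'x, 'a \<times> 'x, 'g) grp_diag"
  assume "group_diagram (opcat (elements D X)) G"
  then interpret element_coefficients D X G
    using assms by unfold_locales
  show "left_Kan TYPE('h) (opcat (elements D X)) (opcat D) forget G (chain_diag D X G) (chain_unit X G)"
    by (rule chain_left_Kan)
  show "\<forall>a\<in>Ob D. gob (chain_diag D X G) a = free_product (sob X a) (\<lambda>z. gob G (a, z))"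
    by (simp add: chain_gob)
  show "\<forall>\<alpha>\<in>Ar D. \<forall>x\<in>sob X (Cod D \<alpha>). \<forall>g\<in>carrier (gob G (Cod D \<alpha>, x)).
      gar (chain_diag D X G) \<alpha> (fp_incl (sob X (Cod D \<alpha>)) (\<lambda>z. gob G (Cod D \<alpha>, z)) x g) =
      fp_incl (sob X (Dom D \<alpha>)) (\<lambda>z. gob G (Dom D \<alpha>, z)) (sar X \<alpha> x) (gar G (\<alpha>, x) g)"
    by (simp add: chain_gar_incl)
qed

end
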